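(* Let $a\in L^1(0,1)$ satisfy $\int_0^1 a(x)\,dx<0$ and $a(x)>0$ on a set of positive measure. Let $f\in\mathcal C(\mathbb R)$ satisfy $f(0)=0$, $f(u)>0$ for $u>0$, and, for some constants $h>0$, $p>0$ and $q\in(0,1)$, $$\lim_{u\to0^+}\frac{f(u)}{u^p}=1,\qquad \lim_{u\to\infty}\frac{f(u)}{u^{-q}}=h.$$ Then the problem $$-\left(\frac{u'}{\sqrt{1+(u')^2}}\right)'=\lambda a(x)f(u),\quad 0<x<1,\qquad u'(0)=u'(1)=0,$$ has no positive singular solution for sufficiently small $\lambda\ge0$; that is, there is $\overline\lambda>0$ such that for every $\lambda\in[0,\overline\lambda)$ there is no positive singular solution.
   Context: A function $u\in BV(0,1)$ is a bounded variation solution of the problem (for a given $\lambda$) if $$\int_0^1 \frac{Du^a\,D\phi^a}{\sqrt{1+(Du^a)^2}}\,dx+\int_0^1\frac{Du^s}{|Du^s|}\,D\phi^s=\int_0^1\lambda a f(u)\phi\,dx$$ for every $\phi\in BV(0,1)$ such that $|D\phi^s|$ is absolutely continuous with respect to $|Du^s|$. Here, for $v\in BV(0,1)$, $Dv=Dv^a\,dx+Dv^s$ is the Lebesgue decomposition of the measure $Dv$ (with $Dv^a$ the density of the absolutely continuous part and $Dv^s$ the singular part), and $\frac{Dv^s}{|Dv^s|}$ is the density of $Dv^s$ with respect to its total variation $|Dv^s|$. A regular solution is a function $u\in W^{2,1}(0,1)$ satisfying the equation a.e. in $(0,1)$ and the boundary conditions. A bounded variation solution which is not regular is called singular. A solution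 $u$ is positive if $\operatorname{ess\,inf}u\ge0$ and $\operatorname{ess\,sup}u>0$. *)

theory Defs
  imports "HOL-Probability.Essential_Supremum"
begin

section \<open>Finite signed measures\<close>

text \<open>A finite signed measure on \<open>M\<close> is a real-valued set function; only its values on
  \<open>sets M\<close> matter.\<close>

definition signed_measure_on :: "'a measure \<Rightarrow> ('a set \<Rightarrow> real) \<Rightarrow> bool" where
  "signed_measure_on M \<mu> \<longleftrightarrow>
     \<mu> {} = 0 \<and>
     (\<forall>A :: nat \<Rightarrow> 'a set. range A \<subseteq> sets M \<longrightarrow> disjoint_family A \<longrightarrow>
        (\<lambda>i. \<mu> (A i)) sums \<mu> (\<Union>i. A i))"

definition total_variation :: "'a measure \<Rightarrow> ('a set \<Rightarrow> real) \<Rightarrow> 'a measure" where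
  "total_variation M \<mu> = measure_of (space M) (sets M)
     (\<lambda>A. SUP E \<in> {E :: nat \<Rightarrow> 'a set. range E \<subseteq> sets M \<and> disjoint_family E \<and> (\<Union>i. E i) = A}.
            (\<Sum>i. ennreal \<bar>\<mu> (E i)\<bar>))"

text \<open>The density \<open>\<mu>/\<bar>\<mu>\<bar>\<close>, which is unique up to \<open>\<bar>\<mu>\<bar>\<close>-null sets.\<close>

definition polar_density :: "'a measure \<Rightarrow> ('a set \<Rightarrow> real) \<Rightarrow> 'a \<Rightarrow> real" where
  "polar_density M \<mu> =
     (SOME \<sigma>. integrable (total_variation M \<mu>) \<sigma> \<and>
            (\<forall>A \<in> sets M. \<mu> A = (LINT x:A|total_variation M \<mu>. \<sigma> x)))"

definition signed_integral :: "'a measure \<Rightarrow> ('a set \<Rightarrow> real) \<Rightarrow> ('a \<Rightarrow> real) \<Rightarrow> real" where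
  "signed_integral M \<mu> f = (LINT x|total_variation M \<mu>. f x * polar_density M \<mu> x)"


section \<open>Functions of bounded variation on the unit interval\<close>

abbreviation I01 :: "real set" where
  "I01 \<equiv> {0<..<1}"

abbreviation borel01 :: "real measure" where
  "borel01 \<equiv> restrict_space borel I01"

abbreviation leb01 :: "real measure" where
  "leb01 \<equiv> lebesgue_on I01"

definition test_function :: "(real \<Rightarrow> real) \<Rightarrow> bool" where
  "test_function \<phi> \<longleftrightarrow>
     \<phi> C1_differentiable_on UNIV \<and> (\<exists>K. compact K \<and> K \<subseteq> I01 \<and> (\<forall>x. x \<notin> K \<longrightarrow> \<phi> x = 0))"

definition is_derivative_measure :: "(real \<Rightarrow> real) \<Rightarrow> (real set \<Rightarrow> real) \<Rightarrow> bool" where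
  "is_derivative_measure v \<mu> \<longleftrightarrow>
     signed_measure_on borel01 \<mu> \<and>
     (\<forall>\<phi>. test_function \<phi> \<longrightarrow>
        (LINT x|leb01. v x * deriv \<phi> x) = - signed_integral borel01 \<mu> \<phi>)"

text \<open>As with all function spaces below, members are functions on the whole line of which only
  the equivalence class modulo null sets of \<open>(0,1)\<close> matters.\<close>

definition BV01 :: "(real \<Rightarrow> real) set" where
  "BV01 = {v. integrable leb01 v \<and> (\<exists>\<mu>. is_derivative_measure v \<mu>)}"

text \<open>For \<open>v\<close> in \<open>BV01\<close> the measure is uniquely determined on the Borel subsets of \<open>(0,1)\<close>.\<close>

definition deriv_measure :: "(real \<Rightarrow> real) \<Rightarrow> real set \<Rightarrow> real" where
  "deriv_measure v = (SOME \<mu>. is_derivative_measure v \<mu>)"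

definition lebesgue_decomposition ::
    "(real set \<Rightarrow> real) \<Rightarrow> (real \<Rightarrow> real) \<Rightarrow> (real set \<Rightarrow> real) \<Rightarrow> bool" where
  "lebesgue_decomposition \<mu> g \<nu> \<longleftrightarrow>
     integrable leb01 g \<and>
     signed_measure_on borel01 \<nu> \<and>
     (\<exists>N \<in> sets borel01. emeasure lborel N = 0 \<and>
        emeasure (total_variation borel01 \<nu>) (I01 - N) = 0) \<and>
     (\<forall>A \<in> sets borel01. \<mu> A = (LINT x:A|leb01. g x) + \<nu> A)"

definition deriv_ac :: "(real \<Rightarrow> real) \<Rightarrow> real \<Rightarrow> real" where
  "deriv_ac v = fst (SOME (g, \<nu>). lebesgue_decomposition (deriv_measure v) g \<nu>)"

definition deriv_sing :: "(real \<Rightarrow> real) \<Rightarrow> real set \<Rightarrow> real" where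
  "deriv_sing v = snd (SOME (g, \<nu>). lebesgue_decomposition (deriv_measure v) g \<nu>)"


section \<open>Solutions of the Neumann problem\<close>

definition bv_solution :: "real \<Rightarrow> (real \<Rightarrow> real) \<Rightarrow> (real \<Rightarrow> real) \<Rightarrow> (real \<Rightarrow> real) \<Rightarrow> bool" where
  "bv_solution lam a f u \<longleftrightarrow>
     u \<in> BV01 \<and>
     (\<forall>\<phi> \<in> BV01.
        absolutely_continuous (total_variation borel01 (deriv_sing u))
                              (total_variation borel01 (deriv_sing \<phi>)) \<longrightarrow>
        (LINT x|leb01. deriv_ac u x * deriv_ac \<phi> x / sqrt (1 + (deriv_ac u x)\<^sup>2))
        + signed_integral borel01 (deriv_sing \<phi>) (polar_density borel01 (deriv_sing u))
        = (LINT x|leb01. lam * a x * f (u x) * \<phi> x))"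

definition weak_deriv :: "(real \<Rightarrow> real) \<Rightarrow> (real \<Rightarrow> real) \<Rightarrow> bool" where
  "weak_deriv v w \<longleftrightarrow>
     integrable leb01 v \<and> integrable leb01 w \<and>
     (\<forall>\<phi>. test_function \<phi> \<longrightarrow>
        (LINT x|leb01. v x * deriv \<phi> x) = - (LINT x|leb01. w x * \<phi> x))"

text \<open>Here \<open>u1\<close> and \<open>u2\<close> are the weak derivatives \<open>u'\<close> and \<open>u''\<close>, so that \<open>u\<close> lies in \<open>W^{2,1}(0,1)\<close>,
  and \<open>z\<close> is the derivative of \<open>u' / sqrt (1 + u'\<^sup>2)\<close>. Since \<open>u'\<close> is in \<open>W^{1,1}(0,1)\<close>, it has a
  unique representative \<open>u1\<close> that is continuous on \<open>[0,1]\<close>; the boundary conditions are imposed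
  on this representative.\<close>

definition regular_solution :: "real \<Rightarrow> (real \<Rightarrow> real) \<Rightarrow> (real \<Rightarrow> real) \<Rightarrow> (real \<Rightarrow> real) \<Rightarrow> bool" where
  "regular_solution lam a f u \<longleftrightarrow>
     (\<exists>u1 u2 z.
        weak_deriv u u1 \<and> weak_deriv u1 u2 \<and>
        weak_deriv (\<lambda>x. u1 x / sqrt (1 + (u1 x)\<^sup>2)) z \<and>
        (AE x in leb01. - z x = lam * a x * f (u x)) \<and>
        continuous_on {0..1} u1 \<and> u1 0 = 0 \<and> u1 1 = 0)"

definition singular_solution :: "real \<Rightarrow> (real \<Rightarrow> real) \<Rightarrow> (real \<Rightarrow> real) \<Rightarrow> (real \<Rightarrow> real) \<Rightarrow> bool" where
  "singular_solution lam a f u \<longleftrightarrow> bv_solution lam a f u \<and> \<not> regular_solution lam a f u"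

text \<open>The essential infimum is written as a limit inferior, dually to the definition of
  \<^const>\<open>esssup\<close>.\<close>

definition ess_positive :: "(real \<Rightarrow> real) \<Rightarrow> bool" where
  "ess_positive u \<longleftrightarrow>
     Liminf (ae_filter leb01) (\<lambda>x. ereal (u x)) \<ge> 0 \<and>
     esssup leb01 (\<lambda>x. ereal (u x)) > 0"

end

theory Submission
  imports Defs
begin

text \<open>Write \<open>b = lam * a * f u\<close> for the right-hand side at a positive solution \<open>u\<close>. Since \<open>f\<close> is
  continuous and tends to zero at infinity, it is bounded on the half-line, so for small \<open>lam\<close> the
  \<open>L\<^sup>1\<close> norm of \<open>b\<close> is smaller than 1. The theorem is that smallness of this norm alone forces a bounded
  variation solution to be regular (\<open>bv_solution_regular_if_small\<close>). Three choices of test functions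
  show this.

  Take first the primitive \<open>\<phi>\<close> of the singular part of the derivative of \<open>u\<close>. The weak formulation
  then says that the total variation \<open>\<tau>\<close> of this singular part is the integral of \<open>b * \<phi>\<close>; since
  \<open>\<bar>\<phi>\<bar> \<le> \<tau>\<close>, this is possible only for \<open>\<tau> = 0\<close> (\<open>bv_solution_singular_part_eq_0\<close>).

  Constants show that the integral of \<open>b\<close> vanishes. Primitives of arbitrary functions \<open>w\<close> then show, by
  Fubini, that the flux \<open>u' / sqrt (1 + u'\<^sup>2)\<close> equals minus the primitive of \<open>b\<close> almost everywhere
  (\<open>bv_solution_flux\<close>). So the flux is absolutely continuous, vanishes at 0 and 1, and is bounded by
  the \<open>L\<^sup>1\<close> norm of \<open>b\<close>, hence away from the values \<open>\<plusminus>1\<close> at which the slope would blow up. Solving for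
  the slope and applying the chain rule for absolutely continuous functions (\<open>chain_rule_primitive\<close>)
  puts \<open>u\<close> into \<open>W^{2,1}\<close> with the Neumann boundary conditions.

  The derivative of a function, its two parts and the polar density of a signed measure are all
  introduced by choice. To use them for the test functions above one needs that these objects exist
  and are unique: the Hahn decomposition and the resulting formula for the total variation, the
  existence and uniqueness of the Lebesgue decomposition (\<open>lebesgue_decomposition_exists\<close>,
  \<open>lebesgue_decomposition_unique\<close>), and the fact that test functions determine a signed measure
  (\<open>derivative_measure_unique\<close>).\<close>

section \<open>Hahn decomposition and total variation of signed measures\<close>

lemma signed_measure_on_empty: "signed_measure_on M \<mu> \<Longrightarrow> \<mu> {} = 0"
  by (simp add: signed_measure_on_def)

lemma signed_measure_on_sums:
  "\<lbrakk>signed_measure_on M \<mu>; range A \<subseteq> sets M; disjoint_family A\<rbrakk> \<Longrightarrow> (\<lambda>i. \<mu> (A i)) sums \<mu> (\<Union>i::nat. A i)"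
  by (simp add: signed_measure_on_def)

lemma signed_measure_on_Un:
  assumes "signed_measure_on M \<mu>" "A \<in> sets M" "B \<in> sets M" "A \<inter> B = {}"
  shows "\<mu> (A \<union> B) = \<mu> A + \<mu> B"
proof -
  have "(\<lambda>i. \<mu> (binaryset A B i)) sums \<mu> (\<Union>i. binaryset A B i)"
    using assms by (intro signed_measure_on_sums) (auto simp: range_binaryset_eq disjoint_family_on_def binaryset_def)
  moreover have "(\<lambda>i. \<mu> (binaryset A B i)) sums (\<mu> A + \<mu> B)"
    using signed_measure_on_empty[OF assms(1)] by (rule binaryset_sums)
  ultimately show ?thesis
    by (simp add: UN_binaryset_eq sums_unique2)
qed

lemma signed_measure_on_split:
  assumes "signed_measure_on M \<mu>" "A \<in> sets M" "B \<in> sets M"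
  shows "\<mu> A = \<mu> (A \<inter> B) + \<mu> (A - B)"
  using signed_measure_on_Un[OF assms(1), of "A \<inter> B" "A - B"] assms
  by (simp add: Int_Diff_Un Int_Diff_disjoint)

lemma signed_measure_on_uminus:
  "signed_measure_on M \<mu> \<Longrightarrow> signed_measure_on M (\<lambda>A. - \<mu> A)"
  by (simp add: signed_measure_on_def sums_minus)

text \<open>One greedy procedure serves twice below. At each stage a set of \<open>Q\<close> with nearly the largest
  available value, up to a factor 2, is removed from what remains. The removed sets are disjoint, so their values form a
  convergent series and tend to zero; hence nothing of positive value survives. Values are truncated
  at 1 because the supremum of \<open>\<mu>\<close> is not yet known to be finite.\<close>

lemma greedy_exhaustion:
  assumes \<mu>: "signed_measure_on M \<mu>" and Q: "Q \<subseteq> sets M" "{} \<in> Q" and X: "X \<in> sets M"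
  obtains D :: "nat \<Rightarrow> 'a set" where "range D \<subseteq> Q" "disjoint_family D" "(\<Union>n. D n) \<subseteq> X"
    "\<And>n. 0 \<le> \<mu> (D n)" "\<And>E. E \<in> Q \<Longrightarrow> E \<subseteq> X - (\<Union>n. D n) \<Longrightarrow> \<mu> E \<le> 0"
proof -
  define good where "good C D \<longleftrightarrow> D \<in> Q \<and> D \<subseteq> C \<and> 0 \<le> \<mu> D \<and>
    (\<forall>E\<in>Q. E \<subseteq> C \<longrightarrow> min 1 (\<mu> E) \<le> 2 * \<mu> D)" for C D
  have ex: "\<exists>D. good C D" for C
  proof -
    define V where "V = {min 1 (\<mu> E) | E. E \<in> Q \<and> E \<subseteq> C}"
    have bdd: "bdd_above V"
      unfolding V_def by (rule bdd_aboveI[of _ 1]) auto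
    have 0: "0 \<in> V"
      unfolding V_def using Q signed_measure_on_empty[OF \<mu>] by (auto intro!: exI[of _ "{}"])
    have le: "min 1 (\<mu> E) \<le> Sup V" if "E \<in> Q" "E \<subseteq> C" for E
      by (rule cSup_upper[OF _ bdd]) (use that in \<open>auto simp: V_def\<close>)
    have "0 \<le> Sup V" by (rule cSup_upper[OF 0 bdd])
    then consider "Sup V = 0" | "0 < Sup V" by linarith
    then show ?thesis
    proof cases
      case 1
      then have "good C {}"
        unfolding good_def using Q le signed_measure_on_empty[OF \<mu>] by auto
      then show ?thesis by blast
    next
      case 2
      then have "Sup V / 2 < Sup V" by simp
      then obtain v where v: "v \<in> V" "Sup V / 2 < v"
        using less_cSup_iff[OF _ bdd] 0 by blast
      obtain D where "D \<in> Q" "D \<subseteq> C" "v = min 1 (\<mu> D)"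
        using v(1) unfolding V_def by blast
      with v(2) have D: "D \<in> Q" "D \<subseteq> C" "Sup V / 2 < min 1 (\<mu> D)" by auto
      then have "good C D"
        unfolding good_def using le 2 by force
      then show ?thesis by blast
    qed
  qed
  \<comment> \<open>\<open>A n\<close> is what remains of \<open>X\<close> after \<open>n\<close> removals.\<close>
  define step where "step C = (SOME D. good C D)" for C
  have good: "good C (step C)" for C
    unfolding step_def using ex by (rule someI_ex)
  define A where "A = rec_nat X (\<lambda>_ C. C - step C)"
  have A0: "A 0 = X" and AS: "A (Suc n) = A n - step (A n)" for n
    by (simp_all add: A_def)
  define D where "D n = step (A n)" for n
  have DQ: "D n \<in> Q" and DA: "D n \<subseteq> A n" and D0: "0 \<le> \<mu> (D n)"
    and Dmax: "\<And>E. E \<in> Q \<Longrightarrow> E \<subseteq> A n \<Longrightarrow> min 1 (\<mu> E) \<le> 2 * \<mu> (D n)" for n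
    using good[of "A n"] by (auto simp: good_def D_def)
  have decA: "decseq A"
    by (rule decseq_SucI) (auto simp: AS)
  have "D m \<inter> D n = {}" if "m < n" for m n
  proof -
    have "D n \<subseteq> A (Suc m)"
      using DA[of n] decseqD[OF decA, of "Suc m" n] that by auto
    then show ?thesis by (auto simp: AS D_def)
  qed
  then have disj: "disjoint_family D"
    unfolding disjoint_family_on_def by (metis Int_commute linorder_neqE_nat)
  have "summable (\<lambda>n. \<mu> (D n))"
    using signed_measure_on_sums[OF \<mu> _ disj] DQ Q by (auto simp: summable_def)
  then have lim: "(\<lambda>n. 2 * \<mu> (D n)) \<longlonglongrightarrow> 2 * 0"
    by (intro tendsto_intros summable_LIMSEQ_zero)
  have sub: "X - (\<Union>n. D n) \<subseteq> A n" for n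
    by (induction n) (auto simp: A0 AS D_def)
  have "\<mu> E \<le> 0" if "E \<in> Q" "E \<subseteq> X - (\<Union>n. D n)" for E
  proof -
    have "min 1 (\<mu> E) \<le> 2 * 0"
      by (rule LIMSEQ_le_const[OF lim]) (use Dmax[OF that(1)] sub that(2) in blast)
    then show ?thesis by (simp split: if_splits add: min_def)
  qed
  moreover have "(\<Union>n. D n) \<subseteq> X"
    using DA decseqD[OF decA, of 0] A0 by blast
  ultimately show ?thesis
    using that[of D] DQ disj D0 by blast
qed

text \<open>Exhausting a set by subsets of negative value leaves a positive set whose value is at least as
  large. Exhausting the whole space by positive sets then yields \<open>P\<close>: a set of positive value outside
  \<open>P\<close> would contain a positive set that the exhaustion has missed.\<close>

lemma Hahn_decomposition_signed:
  assumes \<mu>: "signed_measure_on M \<mu>"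
  obtains P where "P \<in> sets M" "\<And>C. C \<in> sets M \<Longrightarrow> C \<subseteq> P \<Longrightarrow> 0 \<le> \<mu> C"
    "\<And>C. C \<in> sets M \<Longrightarrow> C \<inter> P = {} \<Longrightarrow> \<mu> C \<le> 0"
proof -
  define Q where "Q = {B \<in> sets M. \<forall>C\<in>sets M. C \<subseteq> B \<longrightarrow> 0 \<le> \<mu> C}"
  have Q: "Q \<subseteq> sets M" "{} \<in> Q"
    using signed_measure_on_empty[OF \<mu>] by (auto simp: Q_def)
  have pos: "\<exists>B\<in>Q. B \<subseteq> A \<and> \<mu> A \<le> \<mu> B" if A: "A \<in> sets M" for A
  proof -
    obtain D :: "nat \<Rightarrow> 'a set" where D: "range D \<subseteq> sets M" "disjoint_family D" "(\<Union>n. D n) \<subseteq> A"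
      "\<And>n. 0 \<le> - \<mu> (D n)" "\<And>E. E \<in> sets M \<Longrightarrow> E \<subseteq> A - (\<Union>n. D n) \<Longrightarrow> - \<mu> E \<le> 0"
      using greedy_exhaustion[OF signed_measure_on_uminus[OF \<mu>], of "sets M" A] A by auto
    have UD: "(\<Union>n. D n) \<in> sets M"
      using D(1) by auto
    have "\<mu> (\<Union>n. D n) \<le> 0"
      by (rule sums_le[OF _ signed_measure_on_sums[OF \<mu> D(1,2)] sums_zero]) (use D(4) in simp)
    moreover have "\<mu> A = \<mu> (\<Union>n. D n) + \<mu> (A - (\<Union>n. D n))"
      using signed_measure_on_split[OF \<mu> A UD] D(3) by (simp add: Int_absorb1)
    moreover have "A - (\<Union>n. D n) \<in> Q"
      using A UD D(5) by (force simp: Q_def)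
    ultimately show ?thesis by (intro bexI[of _ "A - (\<Union>n. D n)"]) auto
  qed
  obtain D :: "nat \<Rightarrow> 'a set" where D: "range D \<subseteq> Q" "disjoint_family D"
      "\<And>E. E \<in> Q \<Longrightarrow> E \<subseteq> space M - (\<Union>n. D n) \<Longrightarrow> \<mu> E \<le> 0"
    using greedy_exhaustion[OF \<mu> Q sets.top] by metis
  define P where "P = (\<Union>n. D n)"
  have P: "P \<in> sets M" using D(1) Q(1) by (auto simp: P_def)
  show ?thesis
  proof (rule that[OF P])
    fix C assume C: "C \<in> sets M" "C \<subseteq> P"
    have "range (\<lambda>n. C \<inter> D n) \<subseteq> sets M"
      using C(1) D(1) Q(1) by (auto intro!: sets.Int)
    moreover have "disjoint_family (\<lambda>n. C \<inter> D n)"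
      using D(2) unfolding disjoint_family_on_def by blast
    ultimately have "(\<lambda>n. \<mu> (C \<inter> D n)) sums \<mu> (\<Union>n. C \<inter> D n)"
      by (rule signed_measure_on_sums[OF \<mu>])
    moreover have "(\<Union>n. C \<inter> D n) = C" using C(2) by (auto simp: P_def)
    moreover have "0 \<le> \<mu> (C \<inter> D n)" for n
    proof -
      have "D n \<in> Q" using D(1) by blast
      then show ?thesis using C(1) by (auto simp: Q_def)
    qed
    ultimately show "0 \<le> \<mu> C"
      using sums_le[OF _ sums_zero, of "\<lambda>n. \<mu> (C \<inter> D n)" "\<mu> C"] by simp
  next
    fix C assume C: "C \<in> sets M" "C \<inter> P = {}"
    obtain B where B: "B \<in> Q" "B \<subseteq> C" "\<mu> C \<le> \<mu> B" using pos[OF C(1)] by blast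
    have "\<mu> B \<le> 0"
      using B(1,2) C sets.sets_into_space[OF C(1)] by (intro D(3)) (auto simp: P_def)
    then show "\<mu> C \<le> 0" using B(3) by linarith
  qed
qed

lemma sets_total_variation [simp, measurable_cong]: "sets (total_variation M \<mu>) = sets M"
  unfolding total_variation_def by simp

lemma space_total_variation [simp]: "space (total_variation M \<mu>) = space M"
  unfolding total_variation_def by simp

text \<open>Along a Hahn decomposition the supremum over partitions is attained by splitting \<open>A\<close> into its
  positive and its negative part. This makes the set function that defines the total variation
  countably additive, so that the measure built from it takes these values, and it shows that the
  total variation of a real-valued signed measure is finite.\<close>

lemma emeasure_total_variation_Hahn:
  assumes \<mu>: "signed_measure_on M \<mu>" and P: "P \<in> sets M"
    and pos: "\<And>C. C \<in> sets M \<Longrightarrow> C \<subseteq> P \<Longrightarrow> 0 \<le> \<mu> C"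
    and neg: "\<And>C. C \<in> sets M \<Longrightarrow> C \<inter> P = {} \<Longrightarrow> \<mu> C \<le> 0"
    and A: "A \<in> sets M"
  shows "emeasure (total_variation M \<mu>) A = ennreal (\<mu> (A \<inter> P) - \<mu> (A - P))"
proof -
  define m where "m A = \<mu> (A \<inter> P) - \<mu> (A - P)" for A
  define t where "t A = (SUP E \<in> {E :: nat \<Rightarrow> 'a set. range E \<subseteq> sets M \<and> disjoint_family E \<and> (\<Union>i. E i) = A}.
            (\<Sum>i. ennreal \<bar>\<mu> (E i)\<bar>))" for A
  have pn: "0 \<le> \<mu> (X \<inter> P)" "\<mu> (X - P) \<le> 0" if "X \<in> sets M" for X
    using that P by (auto intro!: pos neg)
  have m_nonneg: "0 \<le> m A" if "A \<in> sets M" for A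
    unfolding m_def using pn[OF that] by linarith
  have m_sums: "(\<lambda>i. m (E i)) sums m (\<Union>i. E i)" if E: "range E \<subseteq> sets M" "disjoint_family E" for E :: "nat \<Rightarrow> _"
  proof -
    have "(\<lambda>i. \<mu> (E i \<inter> P)) sums \<mu> (\<Union>i. E i \<inter> P)"
      using E P by (intro signed_measure_on_sums[OF \<mu>]) (auto simp: disjoint_family_on_def)
    moreover have "(\<lambda>i. \<mu> (E i - P)) sums \<mu> (\<Union>i. E i - P)"
      using E P by (intro signed_measure_on_sums[OF \<mu>]) (auto simp: disjoint_family_on_def)
    moreover have "(\<Union>i. E i \<inter> P) = (\<Union>i. E i) \<inter> P" "(\<Union>i. E i - P) = (\<Union>i. E i) - P" by auto
    ultimately show ?thesis unfolding m_def by (auto intro: sums_diff)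
  qed
  have suminf_m: "(\<Sum>i. ennreal (m (E i))) = ennreal (m (\<Union>i. E i))"
    if E: "range E \<subseteq> sets M" "disjoint_family E" for E :: "nat \<Rightarrow> _"
    using m_sums[OF E] E by (intro suminf_ennreal_eq m_nonneg) auto
  have t: "t A = ennreal (m A)" if A: "A \<in> sets M" for A
  proof (rule antisym)
    show "t A \<le> ennreal (m A)"
      unfolding t_def
    proof (rule SUP_least, clarify)
      fix E :: "nat \<Rightarrow> 'a set" assume E: "range E \<subseteq> sets M" "disjoint_family E"
      have "\<bar>\<mu> (E i)\<bar> \<le> m (E i)" for i
      proof -
        have "E i \<in> sets M" using E by auto
        then show ?thesis
          using signed_measure_on_split[OF \<mu> _ P, of "E i"] pn[of "E i"]
          unfolding m_def by linarith
      qed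
      then have "(\<Sum>i. ennreal \<bar>\<mu> (E i)\<bar>) \<le> (\<Sum>i. ennreal (m (E i)))"
        by (intro suminf_le summableI ennreal_leI)
      then show "(\<Sum>i. ennreal \<bar>\<mu> (E i)\<bar>) \<le> ennreal (m (\<Union> (range E)))"
        using suminf_m[OF E] by simp
    qed
    let ?E = "binaryset (A \<inter> P) (A - P)"
    have E: "range ?E \<subseteq> sets M" "disjoint_family ?E" "(\<Union>i. ?E i) = A"
      using A P by (auto simp: range_binaryset_eq disjoint_family_on_def binaryset_def UN_binaryset_eq split: if_splits)
    have "\<bar>\<mu> (?E i)\<bar> = m (?E i)" for i
    proof -
      have "(A \<inter> P) \<inter> P = A \<inter> P" "A \<inter> P - P = {}" "(A - P) \<inter> P = {}" "(A - P) - P = A - P"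
        by auto
      then have "m (A \<inter> P) = \<mu> (A \<inter> P)" "m (A - P) = - \<mu> (A - P)"
        unfolding m_def using signed_measure_on_empty[OF \<mu>] by (simp_all only:)
      moreover have "m {} = 0" unfolding m_def by simp
      ultimately show ?thesis
        using pn[OF A] signed_measure_on_empty[OF \<mu>] by (simp add: binaryset_def)
    qed
    then have "(\<Sum>i. ennreal \<bar>\<mu> (?E i)\<bar>) = ennreal (m A)"
      using suminf_m[OF E(1,2)] E(3) by simp
    then show "ennreal (m A) \<le> t A"
      unfolding t_def using E by (intro SUP_upper2[of ?E]) auto
  qed
  have "emeasure (total_variation M \<mu>) A = t A"
  proof (rule emeasure_measure_of[OF total_variation_def[of M \<mu>, folded t_def]])
    show "positive (sets (total_variation M \<mu>)) t"
      using t[of "{}"] signed_measure_on_empty[OF \<mu>] by (simp add: positive_def m_def)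
    show "countably_additive (sets (total_variation M \<mu>)) t"
    proof (rule countably_additiveI)
      fix E :: "nat \<Rightarrow> 'a set"
      assume E: "range E \<subseteq> sets (total_variation M \<mu>)" "disjoint_family E" "(\<Union>i. E i) \<in> sets (total_variation M \<mu>)"
      then have "t (E i) = ennreal (m (E i))" for i by (intro t) auto
      moreover have "t (\<Union>i. E i) = ennreal (m (\<Union>i. E i))" using E(3) by (intro t) simp
      ultimately show "(\<Sum>i. t (E i)) = t (\<Union>i. E i)"
        using suminf_m[of E] E(1,2) by simp
    qed
  qed (use A sets.space_closed in auto)
  then show ?thesis using t[OF A] by (simp add: m_def)
qed

lemma finite_measure_total_variation:
  assumes \<mu>: "signed_measure_on M \<mu>"
  shows "finite_measure (total_variation M \<mu>)"
proof -
  obtain P where "P \<in> sets M" "\<And>C. C \<in> sets M \<Longrightarrow> C \<subseteq> P \<Longrightarrow> 0 \<le> \<mu> C"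
    "\<And>C. C \<in> sets M \<Longrightarrow> C \<inter> P = {} \<Longrightarrow> \<mu> C \<le> 0"
    using Hahn_decomposition_signed[OF \<mu>] by blast
  then have "emeasure (total_variation M \<mu>) (space M) = ennreal (\<mu> (space M \<inter> P) - \<mu> (space M - P))"
    by (intro emeasure_total_variation_Hahn[OF \<mu>]) auto
  then show ?thesis by (intro finite_measureI) simp
qed

lemma emeasure_total_variation_eq_0:
  assumes \<mu>: "signed_measure_on M \<mu>" and A: "A \<in> sets M"
    and 0: "\<And>C. C \<in> sets M \<Longrightarrow> C \<subseteq> A \<Longrightarrow> \<mu> C = 0"
  shows "emeasure (total_variation M \<mu>) A = 0"
proof -
  obtain P where P: "P \<in> sets M" "\<And>C. C \<in> sets M \<Longrightarrow> C \<subseteq> P \<Longrightarrow> 0 \<le> \<mu> C"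
    "\<And>C. C \<in> sets M \<Longrightarrow> C \<inter> P = {} \<Longrightarrow> \<mu> C \<le> 0"
    using Hahn_decomposition_signed[OF \<mu>] by blast
  have "emeasure (total_variation M \<mu>) A = ennreal (\<mu> (A \<inter> P) - \<mu> (A - P))"
    by (rule emeasure_total_variation_Hahn[OF \<mu> P A])
  moreover have "\<mu> (A \<inter> P) = 0" "\<mu> (A - P) = 0"
    using A P(1) by (auto intro!: 0)
  ultimately show ?thesis by simp
qed

lemma total_variation_cong:
  assumes eq: "\<And>A. A \<in> sets M \<Longrightarrow> \<mu> A = \<nu> A"
  shows "total_variation M \<mu> = total_variation M \<nu>"
proof -
  define t where "t \<rho> A = (SUP E \<in> {E :: nat \<Rightarrow> 'a set. range E \<subseteq> sets M \<and> disjoint_family E \<and> (\<Union>i. E i) = A}.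
            (\<Sum>i. ennreal \<bar>\<rho> (E i)\<bar>))" for \<rho> :: "'a set \<Rightarrow> real" and A
  have "t \<mu> A = t \<nu> A" for A
    unfolding t_def
  proof (intro SUP_cong refl)
    fix E :: "nat \<Rightarrow> 'a set"
    assume "E \<in> {E. range E \<subseteq> sets M \<and> disjoint_family E \<and> (\<Union>i. E i) = A}"
    then have "\<mu> (E i) = \<nu> (E i)" for i
      using eq[of "E i"] by auto
    then show "(\<Sum>i. ennreal \<bar>\<mu> (E i)\<bar>) = (\<Sum>i. ennreal \<bar>\<nu> (E i)\<bar>)"
      by simp
  qed
  then have "t \<mu> = t \<nu>" by (rule ext)
  then show ?thesis
    unfolding total_variation_def t_def by (rule arg_cong)
qed

lemma polar_density_cong:
  assumes "\<And>A. A \<in> sets M \<Longrightarrow> \<mu> A = \<nu> A"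
  shows "polar_density M \<mu> = polar_density M \<nu>"
proof -
  have "total_variation M \<mu> = total_variation M \<nu>"
    using assms by (rule total_variation_cong)
  then show ?thesis unfolding polar_density_def using assms by (simp cong: ball_cong)
qed

section \<open>Densities and the polar density\<close>

text \<open>Every signed measure met in the proof is an integral against a measure \<open>T\<close>: a derivative measure
  against its total variation, an absolutely continuous one against Lebesgue measure. The
  \<open>\<sigma>\<close>-algebra of \<open>T\<close> may be larger than that of \<open>M\<close>, so that \<open>M\<close> can be the Borel sets and \<open>T\<close>
  Lebesgue measure.\<close>

definition has_density_on :: "'a measure \<Rightarrow> ('a set \<Rightarrow> real) \<Rightarrow> 'a measure \<Rightarrow> ('a \<Rightarrow> real) \<Rightarrow> bool" where
  "has_density_on M \<mu> T s \<longleftrightarrow> space T = space M \<and> sets M \<subseteq> sets T \<and> integrable T s \<and>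
     (\<forall>A\<in>sets M. \<mu> A = (LINT x:A|T. s x))"

lemma has_density_onD:
  assumes "has_density_on M \<mu> T s"
  shows "space T = space M" "sets M \<subseteq> sets T" "integrable T s"
    and "\<And>A. A \<in> sets M \<Longrightarrow> \<mu> A = (LINT x:A|T. s x)"
  using assms by (auto simp: has_density_on_def)

lemma measurable_larger_sets:
  assumes "space T = space M" "sets M \<subseteq> sets T" "f \<in> M \<rightarrow>\<^sub>M N"
  shows "f \<in> T \<rightarrow>\<^sub>M N"
  using assms unfolding measurable_def by auto

lemma signed_measure_on_density:
  assumes "has_density_on M \<mu> T s"
  shows "signed_measure_on M \<mu>"
  unfolding signed_measure_on_def
proof (intro conjI allI impI)
  note d = has_density_onD[OF assms]
  show "\<mu> {} = 0" using d(4)[of "{}"] by (simp add: set_lebesgue_integral_def)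
  fix A :: "nat \<Rightarrow> 'a set"
  assume A: "range A \<subseteq> sets M" "disjoint_family A"
  have AT: "A i \<in> sets T" for i using A(1) d(2) by auto
  have UA: "(\<Union>i. A i) \<in> sets M" using A(1) by auto
  have "(\<lambda>i. LINT x|T. indicator (A i) x *\<^sub>R s x) sums (LINT x|T. (\<Sum>i. indicator (A i) x *\<^sub>R s x))"
  proof (rule sums_integral)
    show "integrable T (\<lambda>x. indicator (A i) x *\<^sub>R s x)" for i
      using AT d(3) by (rule integrable_mult_indicator)
    have one: "\<exists>i. \<forall>j. j \<noteq> i \<longrightarrow> x \<notin> A j" for x
      using A(2) unfolding disjoint_family_on_def by blast
    have sm: "summable (\<lambda>i. norm (indicator (A i) x *\<^sub>R s x))" for x
    proof -
      obtain i where "\<forall>j. j \<noteq> i \<longrightarrow> x \<notin> A j" using one by blast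
      then show ?thesis
        by (intro summable_finite[of "{i}"]) (auto simp: indicator_def)
    qed
    then show "AE x in T. summable (\<lambda>i. norm (indicator (A i) x *\<^sub>R s x))" by simp
    show "summable (\<lambda>i. LINT x|T. norm (indicator (A i) x *\<^sub>R s x))"
    proof (rule summableI_nonneg_bounded)
      show "0 \<le> (LINT x|T. norm (indicator (A i) x *\<^sub>R s x))" for i by simp
      fix n
      have fin: "(\<Sum>i<n. norm (indicator (A i) x *\<^sub>R s x)) \<le> norm (s x)" for x
      proof -
        obtain i where i: "\<forall>j. j \<noteq> i \<longrightarrow> x \<notin> A j" using one by blast
        have "(\<Sum>j<n. norm (indicator (A j) x *\<^sub>R s x)) \<le> (\<Sum>j<n. if j = i then norm (s x) else 0)"
          using i by (intro sum_mono) (auto simp: indicator_def)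
        also have "\<dots> \<le> norm (s x)" by simp
        finally show ?thesis .
      qed
      have "(\<Sum>i<n. LINT x|T. norm (indicator (A i) x *\<^sub>R s x)) = (LINT x|T. (\<Sum>i<n. norm (indicator (A i) x *\<^sub>R s x)))"
        by (rule Bochner_Integration.integral_sum[symmetric]) (intro integrable_norm integrable_mult_indicator AT d(3))
      also have "\<dots> \<le> (LINT x|T. norm (s x))"
        by (intro integral_mono Bochner_Integration.integrable_sum integrable_norm integrable_mult_indicator AT d(3) fin)
      finally show "(\<Sum>i<n. LINT x|T. norm (indicator (A i) x *\<^sub>R s x)) \<le> (LINT x|T. norm (s x))" .
    qed
  qed
  moreover have "(\<Sum>i. indicator (A i) x *\<^sub>R s x) = indicator (\<Union>i. A i) x *\<^sub>R s x" for x
  proof (cases "x \<in> (\<Union>i. A i)")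
    case True
    then obtain k where k: "x \<in> A k" by blast
    then have "x \<notin> A j" if "j \<noteq> k" for j
      using A(2) that unfolding disjoint_family_on_def by blast
    then have "(\<Sum>i. indicator (A i) x *\<^sub>R s x) = (\<Sum>i\<in>{k}. indicator (A i) x *\<^sub>R s x)"
      by (intro suminf_finite) auto
    then show ?thesis using True k by simp
  qed simp
  ultimately show "(\<lambda>i. \<mu> (A i)) sums \<mu> (\<Union>i. A i)"
    using d(4) A(1) UA by (auto simp: set_lebesgue_integral_def subset_iff)
qed

lemma integrable_bounded_mult:
  fixes s \<phi> :: "'a \<Rightarrow> real"
  assumes "integrable T s" "\<phi> \<in> borel_measurable T" "\<And>x. x \<in> space T \<Longrightarrow> \<bar>\<phi> x\<bar> \<le> B"
  shows "integrable T (\<lambda>x. \<phi> x * s x)"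
proof (rule Bochner_Integration.integrable_bound)
  show "integrable T (\<lambda>x. B * \<bar>s x\<bar>)" using assms(1) by auto
  show "(\<lambda>x. \<phi> x * s x) \<in> borel_measurable T" using assms by measurable
  show "AE x in T. norm (\<phi> x * s x) \<le> norm (B * \<bar>s x\<bar>)"
  proof (rule AE_I2)
    fix x assume "x \<in> space T"
    then have "\<bar>\<phi> x\<bar> * \<bar>s x\<bar> \<le> \<bar>B\<bar> * \<bar>s x\<bar>"
      using assms(3)[of x] by (intro mult_right_mono) auto
    then show "norm (\<phi> x * s x) \<le> norm (B * \<bar>s x\<bar>)" by (simp add: abs_mult)
  qed
qed

lemma integral_density_cong_nonneg:
  assumes d1: "has_density_on M \<mu> T1 s1" and d2: "has_density_on M \<mu> T2 s2"
    and \<phi>: "\<phi> \<in> borel_measurable M" "\<And>x. 0 \<le> \<phi> x" "\<And>x. x \<in> space M \<Longrightarrow> \<phi> x \<le> B"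
  shows "(LINT x|T1. \<phi> x * s1 x) = (LINT x|T2. \<phi> x * s2 x)"
proof -
  note D1 = has_density_onD[OF d1] and D2 = has_density_onD[OF d2]
  note m1 = measurable_larger_sets[OF D1(1,2)] and m2 = measurable_larger_sets[OF D2(1,2)]
  have "\<forall>B. (\<forall>x\<in>space M. \<phi> x \<le> B) \<longrightarrow> (LINT x|T1. \<phi> x * s1 x) = (LINT x|T2. \<phi> x * s2 x)"
    using \<phi>(1,2)
  proof (induction rule: borel_measurable_induct_real)
    case (set A)
    then show ?case
      using D1(4)[OF set] D2(4)[OF set] by (simp add: set_lebesgue_integral_def)
  next
    case (mult u c)
    show ?case
    proof (intro allI impI)
      fix B assume B: "\<forall>x\<in>space M. c * u x \<le> B"
      show "(LINT x|T1. c * u x * s1 x) = (LINT x|T2. c * u x * s2 x)"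
      proof (cases "c = 0")
        case False
        then have "\<forall>x\<in>space M. u x \<le> B / c"
          using B mult(1) by (simp add: field_simps)
        then have "(LINT x|T1. u x * s1 x) = (LINT x|T2. u x * s2 x)"
          using mult by blast
        then show ?thesis by (simp add: mult.assoc)
      qed simp
    qed
  next
    case (add u v)
    show ?case
    proof (intro allI impI)
      fix B assume B: "\<forall>x\<in>space M. v x + u x \<le> B"
      have uB: "\<And>x. x \<in> space M \<Longrightarrow> u x \<le> B" and vB: "\<And>x. x \<in> space M \<Longrightarrow> v x \<le> B"
        using B add by (smt (verit))+
      then have e: "(LINT x|T1. u x * s1 x) = (LINT x|T2. u x * s2 x)"
        "(LINT x|T1. v x * s1 x) = (LINT x|T2. v x * s2 x)" using add by blast+
      have "integrable T1 (\<lambda>x. u x * s1 x)" "integrable T1 (\<lambda>x. v x * s1 x)"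
        using uB vB add D1 by (auto intro!: integrable_bounded_mult[where B=B] m1)
      moreover have "integrable T2 (\<lambda>x. u x * s2 x)" "integrable T2 (\<lambda>x. v x * s2 x)"
        using uB vB add D2 by (auto intro!: integrable_bounded_mult[where B=B] m2)
      ultimately show "(LINT x|T1. (v x + u x) * s1 x) = (LINT x|T2. (v x + u x) * s2 x)"
        using e by (simp add: distrib_right)
    qed
  next
    case (seq U)
    show ?case
    proof (intro allI impI)
      fix B assume B: "\<forall>x\<in>space M. \<phi> x \<le> B"
      have UB: "U i x \<le> B" if "x \<in> space M" for i x
      proof -
        have "U i x \<le> \<phi> x"
          by (rule incseq_le[OF _ seq(4)[OF that]]) (use seq(3) in \<open>auto simp: incseq_def le_fun_def\<close>)
        then show ?thesis using B that by fastforce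
      qed
      have lim: "(\<lambda>i. LINT x|T. U i x * s x) \<longlonglongrightarrow> (LINT x|T. \<phi> x * s x)"
        if T: "has_density_on M \<mu> T s" for T s
      proof (rule integral_dominated_convergence[where w="\<lambda>x. B * \<bar>s x\<bar>"])
        note D = has_density_onD[OF T]
        have [measurable]: "s \<in> borel_measurable T" using D(3) by auto
        have [measurable]: "\<phi> \<in> borel_measurable T" "U i \<in> borel_measurable T" for i
          using measurable_larger_sets[OF D(1,2) \<phi>(1)] measurable_larger_sets[OF D(1,2) seq(1)] by blast+
        show "(\<lambda>x. \<phi> x * s x) \<in> borel_measurable T" by measurable
        show "(\<lambda>x. U i x * s x) \<in> borel_measurable T" for i by measurable
        show "integrable T (\<lambda>x. B * \<bar>s x\<bar>)" using D(3) by auto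
        show "AE x in T. (\<lambda>i. U i x * s x) \<longlonglongrightarrow> \<phi> x * s x"
          using seq(4) D(1) by (intro AE_I2 tendsto_mult_right) auto
        show "AE x in T. norm (U i x * s x) \<le> B * \<bar>s x\<bar>" for i
          using UB seq(2) D(1) by (intro AE_I2) (auto simp: abs_mult intro!: mult_right_mono)
      qed
      have "(LINT x|T1. U i x * s1 x) = (LINT x|T2. U i x * s2 x)" for i
        using seq(5) UB by blast
      then show "(LINT x|T1. \<phi> x * s1 x) = (LINT x|T2. \<phi> x * s2 x)"
        using lim[OF d1] lim[OF d2] LIMSEQ_unique by simp
    qed
  qed
  then show ?thesis using \<phi>(3) by blast
qed

text \<open>This is why the integral of a bounded measurable function against a signed measure can be computed
  from any representation by a density, in particular without knowing the polar density.\<close>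

lemma integral_density_cong:
  assumes d1: "has_density_on M \<mu> T1 s1" and d2: "has_density_on M \<mu> T2 s2"
    and \<phi>: "\<phi> \<in> borel_measurable M" "\<And>x. x \<in> space M \<Longrightarrow> \<bar>\<phi> x\<bar> \<le> B"
  shows "(LINT x|T1. \<phi> x * s1 x) = (LINT x|T2. \<phi> x * s2 x)"
proof -
  let ?p = "\<lambda>x. max 0 (\<phi> x)" and ?n = "\<lambda>x. max 0 (- \<phi> x)"
  have b: "?p x \<le> B" "?n x \<le> B" if "x \<in> space M" for x using \<phi>(2)[OF that] by auto
  have mM: "?p \<in> borel_measurable M" "?n \<in> borel_measurable M" using \<phi>(1) by auto
  have e: "(LINT x|T1. ?p x * s1 x) = (LINT x|T2. ?p x * s2 x)"
    "(LINT x|T1. ?n x * s1 x) = (LINT x|T2. ?n x * s2 x)"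
    by (rule integral_density_cong_nonneg[OF d1 d2 mM(1), of B] integral_density_cong_nonneg[OF d1 d2 mM(2), of B];
        use b in auto)+
  have "(LINT x|T. \<phi> x * s x) = (LINT x|T. ?p x * s x) - (LINT x|T. ?n x * s x)"
    if "has_density_on M \<mu> T s" for T s
  proof -
    note D = has_density_onD[OF that] note m = measurable_larger_sets[OF D(1,2)]
    have "integrable T (\<lambda>x. ?p x * s x)"
      by (rule integrable_bounded_mult[where B=B, OF D(3) m[OF mM(1)]]) (use b D(1) in auto)
    moreover have "integrable T (\<lambda>x. ?n x * s x)"
      by (rule integrable_bounded_mult[where B=B, OF D(3) m[OF mM(2)]]) (use b D(1) in auto)
    ultimately have "(LINT x|T. ?p x * s x) - (LINT x|T. ?n x * s x) = (LINT x|T. ?p x * s x - ?n x * s x)"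
      by (rule Bochner_Integration.integral_diff[symmetric])
    also have "\<dots> = (LINT x|T. \<phi> x * s x)"
      by (rule Bochner_Integration.integral_cong) (auto simp: max_def)
    finally show ?thesis ..
  qed
  then show ?thesis using d1 d2 e by simp
qed

text \<open>Integrate the sign of the difference. The sign has to be measurable for the smaller
  \<open>\<sigma>\<close>-algebra of \<open>M\<close>, at least after changing it on a null set; this is the role of \<open>\<sigma>\<close>.\<close>

lemma density_AE_unique:
  assumes d1: "has_density_on M \<mu> T s1" and d2: "has_density_on M \<mu> T s2"
    and \<sigma>: "\<sigma> \<in> borel_measurable M" "AE x in T. \<sigma> x = sgn (s1 x - s2 x)"
  shows "AE x in T. s1 x = s2 x"
proof -
  note D1 = has_density_onD[OF d1] and D2 = has_density_onD[OF d2]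
  define \<phi> where "\<phi> x = max (-1) (min 1 (\<sigma> x))" for x
  have \<phi>: "\<phi> \<in> borel_measurable M" "\<bar>\<phi> x\<bar> \<le> 1" for x
    using \<sigma>(1) unfolding \<phi>_def[abs_def] by (auto simp: abs_if)
  have \<phi>T: "\<phi> \<in> borel_measurable T" by (rule measurable_larger_sets[OF D1(1,2) \<phi>(1)])
  have "(LINT x|T. \<bar>s1 x - s2 x\<bar>) = (LINT x|T. \<phi> x * (s1 x - s2 x))"
  proof (rule integral_cong_AE)
    show "AE x in T. \<bar>s1 x - s2 x\<bar> = \<phi> x * (s1 x - s2 x)"
      using \<sigma>(2) by eventually_elim (auto simp: \<phi>_def sgn_if)
  qed (use D1(3) D2(3) \<phi>T in auto)
  also have "\<dots> = (LINT x|T. \<phi> x * s1 x) - (LINT x|T. \<phi> x * s2 x)"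
    using integrable_bounded_mult[OF D1(3) \<phi>T \<phi>(2)] integrable_bounded_mult[OF D2(3) \<phi>T \<phi>(2)]
    by (simp add: right_diff_distrib)
  also have "\<dots> = 0"
    using integral_density_cong[OF d1 d2 \<phi>] by simp
  finally have "AE x in T. \<bar>s1 x - s2 x\<bar> = 0"
    using D1(3) D2(3) by (subst (asm) integral_nonneg_eq_0_iff_AE) auto
  then show ?thesis by simp
qed

text \<open>The density is 1 on the positive set of a Hahn decomposition and -1 off it.\<close>

lemma ex_polar_density:
  assumes \<mu>: "signed_measure_on M \<mu>"
  shows "\<exists>\<sigma>. has_density_on M \<mu> (total_variation M \<mu>) \<sigma> \<and> (\<forall>x. \<bar>\<sigma> x\<bar> = 1)"
proof -
  let ?T = "total_variation M \<mu>"
  interpret finite_measure ?T by (rule finite_measure_total_variation[OF \<mu>])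
  obtain P where P: "P \<in> sets M" "\<And>C. C \<in> sets M \<Longrightarrow> C \<subseteq> P \<Longrightarrow> 0 \<le> \<mu> C"
    "\<And>C. C \<in> sets M \<Longrightarrow> C \<inter> P = {} \<Longrightarrow> \<mu> C \<le> 0"
    using Hahn_decomposition_signed[OF \<mu>] by blast
  have m: "emeasure ?T A = ennreal (\<mu> (A \<inter> P) - \<mu> (A - P))" if "A \<in> sets M" for A
    by (rule emeasure_total_variation_Hahn[OF \<mu> P that])
  define \<sigma> :: "'a \<Rightarrow> real" where "\<sigma> x = indicator P x - indicator (- P) x" for x
  have "\<mu> A = (LINT x:A|?T. \<sigma> x) \<and> integrable ?T \<sigma>" if A: "A \<in> sets M" for A
  proof
    have AP: "A \<inter> P \<in> sets M" "A - P \<in> sets M" using A P(1) by auto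
    have "(LINT x:A|?T. \<sigma> x) = (LINT x|?T. indicator (A \<inter> P) x - indicator (A - P) x)"
      unfolding set_lebesgue_integral_def
      by (rule Bochner_Integration.integral_cong) (auto simp: \<sigma>_def indicator_def)
    also have "\<dots> = measure ?T (A \<inter> P) - measure ?T (A - P)"
      using AP by (subst Bochner_Integration.integral_diff) (auto simp: less_top[symmetric] sets.Int_space_eq2)
    also have "measure ?T (A \<inter> P) = \<mu> (A \<inter> P)"
    proof -
      have "A \<inter> P \<inter> P = A \<inter> P" "A \<inter> P - P = {}" by auto
      then have "emeasure ?T (A \<inter> P) = ennreal (\<mu> (A \<inter> P))"
        using m[OF AP(1)] signed_measure_on_empty[OF \<mu>] by (simp only: diff_0_right)
      then show ?thesis using P(2)[OF AP(1)] by (simp add: measure_def)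
    qed
    also have "measure ?T (A - P) = - \<mu> (A - P)"
    proof -
      have "(A - P) \<inter> P = {}" "A - P - P = A - P" by auto
      then have "emeasure ?T (A - P) = ennreal (- \<mu> (A - P))"
        using m[OF AP(2)] signed_measure_on_empty[OF \<mu>] by (simp only: diff_0)
      moreover have "\<mu> (A - P) \<le> 0" by (rule P(3)[OF AP(2)]) auto
      ultimately show ?thesis by (simp add: measure_def)
    qed
    finally show "\<mu> A = (LINT x:A|?T. \<sigma> x)"
      using signed_measure_on_split[OF \<mu> A P(1)] by simp
    have "integrable ?T (\<lambda>x. indicator P x - indicator (space M - P) x :: real)"
      using P(1) by (intro Bochner_Integration.integrable_diff) (auto simp: less_top[symmetric])
    then show "integrable ?T \<sigma>"
      by (subst Bochner_Integration.integrable_cong[OF refl, where g="\<lambda>x. indicator P x - indicator (space M - P) x"])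
         (auto simp: \<sigma>_def indicator_def)
  qed
  then have "has_density_on M \<mu> ?T \<sigma>"
    unfolding has_density_on_def by (metis order_refl sets.top sets_total_variation space_total_variation)
  moreover have "\<bar>\<sigma> x\<bar> = 1" for x by (simp add: \<sigma>_def indicator_def)
  ultimately show ?thesis by blast
qed

lemma polar_density:
  assumes \<mu>: "signed_measure_on M \<mu>"
  shows "has_density_on M \<mu> (total_variation M \<mu>) (polar_density M \<mu>)"
    and "AE x in total_variation M \<mu>. \<bar>polar_density M \<mu> x\<bar> = 1"
proof -
  let ?T = "total_variation M \<mu>"
  obtain \<sigma> where \<sigma>: "has_density_on M \<mu> ?T \<sigma>" "\<forall>x. \<bar>\<sigma> x\<bar> = 1"
    using ex_polar_density[OF \<mu>] by blast
  have eq: "has_density_on M \<mu> ?T s \<longleftrightarrow> integrable ?T s \<and> (\<forall>A\<in>sets M. \<mu> A = (LINT x:A|?T. s x))" for s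
    by (simp add: has_density_on_def)
  show d: "has_density_on M \<mu> ?T (polar_density M \<mu>)"
  proof -
    let ?Q = "\<lambda>s. integrable ?T s \<and> (\<forall>A\<in>sets M. \<mu> A = (LINT x:A|?T. s x))"
    have "?Q \<sigma>" using \<sigma>(1) unfolding eq .
    then have "?Q (SOME s. ?Q s)" by (rule someI[where P="?Q"])
    then show ?thesis unfolding eq polar_density_def .
  qed
  have "(\<lambda>x. sgn (polar_density M \<mu> x - \<sigma> x)) \<in> borel_measurable ?T"
    using has_density_onD(3)[OF d] has_density_onD(3)[OF \<sigma>(1)] by auto
  then have "AE x in ?T. polar_density M \<mu> x = \<sigma> x"
    by (intro density_AE_unique[OF d \<sigma>(1), where \<sigma>="\<lambda>x. sgn (polar_density M \<mu> x - \<sigma> x)"])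
       (auto cong: measurable_cong_sets)
  then show "AE x in ?T. \<bar>polar_density M \<mu> x\<bar> = 1" using \<sigma>(2) by auto
qed

lemma signed_integral_density:
  assumes "has_density_on M \<mu> T s" "\<phi> \<in> borel_measurable M" "\<And>x. x \<in> space M \<Longrightarrow> \<bar>\<phi> x\<bar> \<le> B"
  shows "signed_integral M \<mu> \<phi> = (LINT x|T. \<phi> x * s x)"
  unfolding signed_integral_def
  by (rule integral_density_cong[OF polar_density(1)[OF signed_measure_on_density[OF assms(1)]] assms])

section \<open>Test functions and uniqueness of the derivative measure\<close>

lemma space_borel01 [simp]: "space borel01 = I01"
  by (simp add: space_restrict_space)

lemma sets_borel01: "A \<in> sets borel01 \<longleftrightarrow> A \<in> sets borel \<and> A \<subseteq> I01"
  by (auto simp: sets_restrict_space_iff)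

lemma sets_borel01_leb01: "sets borel01 \<subseteq> sets leb01"
  by (auto simp: sets_borel01 sets_restrict_space_iff)

lemma finite_measure_leb01: "finite_measure leb01"
  by (rule finite_measure_lebesgue_on) auto

lemma measurable_borel01: "f \<in> borel_measurable borel \<Longrightarrow> f \<in> borel_measurable borel01"
  by (rule measurable_restrict_space1)

lemma integrable_leb01_borel:
  fixes f :: "real \<Rightarrow> real"
  assumes f: "f \<in> borel_measurable borel01"
  shows "integrable leb01 f \<longleftrightarrow> integrable lborel (\<lambda>x. indicator I01 x *\<^sub>R f x)"
    and "integral\<^sup>L leb01 f = integral\<^sup>L lborel (\<lambda>x. indicator I01 x *\<^sub>R f x)"
proof -
  have m: "(\<lambda>x. indicator I01 x *\<^sub>R f x) \<in> borel_measurable lborel"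
    using f by (subst (asm) borel_measurable_restrict_space_iff) (auto simp: mult.commute)
  show "integrable leb01 f \<longleftrightarrow> integrable lborel (\<lambda>x. indicator I01 x *\<^sub>R f x)"
    using integrable_completion[OF m] by (subst integrable_restrict_space) auto
  show "integral\<^sup>L leb01 f = integral\<^sup>L lborel (\<lambda>x. indicator I01 x *\<^sub>R f x)"
    using integral_completion[OF m] by (subst integral_restrict_space) auto
qed

lemma test_functionD:
  assumes "test_function \<phi>"
  shows "(\<phi> has_real_derivative deriv \<phi> x) (at x)" "continuous_on A (deriv \<phi>)" "continuous_on A \<phi>"
    and "x \<notin> I01 \<Longrightarrow> \<phi> x = 0"
proof -
  obtain D where D: "\<And>x. (\<phi> has_vector_derivative D x) (at x)" "continuous_on UNIV D"
    using assms unfolding test_function_def C1_differentiable_on_def by auto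
  have DD: "(\<phi> has_real_derivative D x) (at x)" for x
    using D(1) by (simp add: has_real_derivative_iff_has_vector_derivative)
  then have eq: "deriv \<phi> = D" by (intro ext DERIV_imp_deriv)
  show "(\<phi> has_real_derivative deriv \<phi> x) (at x)" using DD eq by simp
  show "continuous_on A (deriv \<phi>)" using D(2) eq by (auto intro: continuous_on_subset)
  show "continuous_on A \<phi>" using DD by (meson DERIV_continuous_on DERIV_subset subset_UNIV)
  show "x \<notin> I01 \<Longrightarrow> \<phi> x = 0" using assms unfolding test_function_def by blast
qed

lemma test_function_bounds:
  assumes "test_function \<phi>"
  obtains B where "\<And>x. \<bar>\<phi> x\<bar> \<le> B" "\<And>x. x \<in> I01 \<Longrightarrow> \<bar>deriv \<phi> x\<bar> \<le> B"
proof -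
  have "bounded (\<phi> ` {0..1})" "bounded (deriv \<phi> ` {0..1})"
    using test_functionD(2,3)[OF assms] by (auto intro!: compact_imp_bounded compact_continuous_image)
  then obtain B1 B2 where B: "\<forall>x\<in>{0..1}. \<bar>\<phi> x\<bar> \<le> B1" "\<forall>x\<in>{0..1}. \<bar>deriv \<phi> x\<bar> \<le> B2"
    unfolding bounded_iff by auto
  have "\<bar>\<phi> x\<bar> \<le> max B1 B2" for x
  proof (cases "x \<in> {0..1}")
    case False
    then have "\<phi> x = 0" using test_functionD(4)[OF assms] by auto
    moreover have "0 \<le> B1" using B(1) by force
    ultimately show ?thesis by simp
  qed (use B in force)
  moreover have "\<bar>deriv \<phi> x\<bar> \<le> max B1 B2" if "x \<in> I01" for x
  proof -
    have "x \<in> {0..1}" using that by simp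
    then have "\<bar>deriv \<phi> x\<bar> \<le> B2" using B(2) by blast
    then show ?thesis by simp
  qed
  ultimately show ?thesis using that by blast
qed

lemma test_function_measurable:
  assumes "test_function \<phi>"
  shows "\<phi> \<in> borel_measurable borel01" "deriv \<phi> \<in> borel_measurable borel01"
  using test_functionD(2,3)[OF assms, of UNIV]
  by (auto intro!: measurable_borel01 borel_measurable_continuous_onI)

text \<open>The boundary term at 1 is absent because test functions have compact support in the open
  interval; for \<open>t = 0\<close> the integral vanishes for the same reason.\<close>

lemma integral_deriv_test_function:
  assumes \<phi>: "test_function \<phi>" and t: "0 \<le> t" "t < 1"
  shows "(LINT x|leb01. (if t \<le> x then 1 else 0) * deriv \<phi> x) = - \<phi> t"
proof -
  note T = test_functionD[OF \<phi>]
  have [measurable]: "deriv \<phi> \<in> borel_measurable borel"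
    using T(2)[of UNIV] by (rule borel_measurable_continuous_onI)
  have "(LINT x|leb01. (if t \<le> x then 1 else 0) * deriv \<phi> x)
      = (LINT x|lborel. indicator I01 x *\<^sub>R ((if t \<le> x then 1 else 0) * deriv \<phi> x))"
    by (intro integrable_leb01_borel measurable_borel01) measurable
  also have "\<dots> = (LINT x|lborel. deriv \<phi> x * indicator {t..1} x)"
  proof (rule integral_cong_AE)
    have "AE x in lborel. x \<noteq> (0::real) \<and> x \<noteq> 1"
      using AE_lborel_singleton[of "0::real"] AE_lborel_singleton[of "1::real"] by eventually_elim auto
    then show "AE x in lborel. indicator I01 x *\<^sub>R ((if t \<le> x then 1 else 0) * deriv \<phi> x) = deriv \<phi> x * indicator {t..1} x"
      by eventually_elim (use t in \<open>auto simp: indicator_def\<close>)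
  qed measurable
  also have "\<dots> = \<phi> 1 - \<phi> t"
    by (rule integral_FTC_Icc_real)
       (use t T(1) T(2)[of UNIV] in \<open>auto simp: continuous_on_eq_continuous_at\<close>)
  also have "\<phi> 1 = 0" by (rule T(4)) simp
  finally show ?thesis by simp
qed

text \<open>Squaring the positive part is the cheapest way to glue to zero in a continuously differentiable
  way; products of such functions are the bumps from which test functions are made.\<close>

lemma has_real_derivative_pos_part_sq:
  "((\<lambda>x. (max 0 (x - c))\<^sup>2) has_real_derivative 2 * max 0 (x - c)) (at (x::real))"
proof -
  consider "x < c" | "x > c" | "x = c" by linarith
  then show ?thesis
  proof cases
    case 1
    have "((\<lambda>x. 0) has_real_derivative 0) (at x)" by simp
    then have "((\<lambda>x. (max 0 (x - c))\<^sup>2) has_real_derivative 0) (at x)"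
      by (rule has_field_derivative_transform_within_open[where S="{..<c}"]) (use 1 in auto)
    then show ?thesis using 1 by simp
  next
    case 2
    have "((\<lambda>x. (x - c)\<^sup>2) has_real_derivative 2 * (x - c)) (at x)"
      by (auto intro!: derivative_eq_intros)
    then have "((\<lambda>x. (max 0 (x - c))\<^sup>2) has_real_derivative 2 * (x - c)) (at x)"
      by (rule has_field_derivative_transform_within_open[where S="{c<..}"]) (use 2 in auto)
    then show ?thesis using 2 by simp
  next
    case 3
    have "((\<lambda>h. ((max 0 (c + h - c))\<^sup>2 - (max 0 (c - c))\<^sup>2) / h) \<longlongrightarrow> 0) (at 0)"
    proof (rule Lim_null_comparison)
      show "\<forall>\<^sub>F h in at 0. norm (((max 0 (c + h - c))\<^sup>2 - (max 0 (c - c))\<^sup>2) / h) \<le> \<bar>h\<bar>"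
        by (rule always_eventually) (auto simp: max_def power2_eq_square)
      show "((\<lambda>h. \<bar>h\<bar>) \<longlongrightarrow> 0) (at (0::real))"
        by (rule tendsto_eq_intros | simp)+
    qed
    then show ?thesis using 3 by (simp add: DERIV_def)
  qed
qed

lemma C1_pos_part_sq: "(\<lambda>x::real. (max 0 (x - c))\<^sup>2) C1_differentiable_on UNIV"
  unfolding C1_differentiable_on_def
  by (rule exI[of _ "\<lambda>x. 2 * max 0 (x - c)"])
     (auto simp: has_real_derivative_iff_has_vector_derivative[symmetric] has_real_derivative_pos_part_sq
       intro!: continuous_intros)

lemma C1_neg_part_sq: "(\<lambda>x::real. (max 0 (d - x))\<^sup>2) C1_differentiable_on UNIV"
proof -
  have "((\<lambda>x. (max 0 (d - x))\<^sup>2) has_real_derivative - (2 * max 0 (d - x))) (at x)" for x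
    using DERIV_mirror[of "\<lambda>x. (max 0 (x - (-d)))\<^sup>2" "2 * max 0 (d - x)" x]
      has_real_derivative_pos_part_sq[of "-d" "-x"] by simp
  then show ?thesis
    unfolding C1_differentiable_on_def
    by (intro exI[of _ "\<lambda>x. - (2 * max 0 (d - x))"])
       (auto simp: has_real_derivative_iff_has_vector_derivative[symmetric] intro!: continuous_intros)
qed

lemma C1_differentiable_on_power:
  "f C1_differentiable_on S \<Longrightarrow> (\<lambda>x. (f x :: real) ^ n) C1_differentiable_on S"
  by (induction n) auto

text \<open>For a bump \<open>\<psi>\<close> with values in \<open>[0,1]\<close> that is positive exactly on the interval, the powers
  \<open>(1 - \<psi>)^n\<close> tend to the indicator of the complement of the interval.\<close>

lemma indicator_limit_test_functions:
  assumes "0 < c" "d < 1"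
  obtains \<phi> :: "nat \<Rightarrow> real \<Rightarrow> real" where "\<And>n. test_function (\<phi> n)" "\<And>n x. \<bar>\<phi> n x\<bar> \<le> 1"
    "\<And>x. (\<lambda>n. \<phi> n x) \<longlonglongrightarrow> indicator {c<..<d} x"
proof -
  define \<psi> where "\<psi> x = (max 0 (x - c))\<^sup>2 * (max 0 (d - x))\<^sup>2" for x
  define \<phi> where "\<phi> n x = 1 - (1 - \<psi> x) ^ n" for n x
  have \<psi>01: "0 \<le> \<psi> x" "\<psi> x \<le> 1" for x
  proof -
    show "0 \<le> \<psi> x" by (simp add: \<psi>_def)
    show "\<psi> x \<le> 1"
    proof (cases "c < x \<and> x < d")
      case True
      then show ?thesis using assms
        unfolding \<psi>_def by (intro mult_le_one power_le_one) auto
    qed (auto simp: \<psi>_def)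
  qed
  have pos: "0 < \<psi> x \<longleftrightarrow> x \<in> {c<..<d}" for x
    by (auto simp: \<psi>_def max_def zero_less_mult_iff)
  have "test_function (\<phi> n)" for n
    unfolding test_function_def
  proof (intro conjI exI[of _ "{c..d}"] allI impI)
    show "\<phi> n C1_differentiable_on UNIV"
      unfolding \<phi>_def[abs_def] \<psi>_def
      by (intro C1_differentiable_on_diff C1_differentiable_on_const C1_differentiable_on_power
          C1_differentiable_on_mult C1_pos_part_sq C1_neg_part_sq)
    show "compact {c..d}" "{c..d} \<subseteq> I01" using assms by auto
    show "\<phi> n x = 0" if "x \<notin> {c..d}" for x
    proof -
      have "\<psi> x = 0" using that by (auto simp: \<psi>_def)
      then show ?thesis by (simp add: \<phi>_def)
    qed
  qed
  moreover have "\<bar>\<phi> n x\<bar> \<le> 1" for n x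
  proof -
    have "0 \<le> (1 - \<psi> x) ^ n" "(1 - \<psi> x) ^ n \<le> 1"
      using \<psi>01[of x] by (auto intro!: power_le_one)
    then show ?thesis by (simp add: \<phi>_def)
  qed
  moreover have "(\<lambda>n. \<phi> n x) \<longlonglongrightarrow> indicator {c<..<d} x" for x
  proof (cases "x \<in> {c<..<d}")
    case True
    then have "\<bar>1 - \<psi> x\<bar> < 1" using pos[of x] \<psi>01[of x] by auto
    then have "(\<lambda>n. (1 - \<psi> x) ^ n) \<longlonglongrightarrow> 0" by (rule LIMSEQ_abs_realpow_zero2)
    then have "(\<lambda>n. 1 - (1 - \<psi> x) ^ n) \<longlonglongrightarrow> 1 - 0" by (rule tendsto_diff[OF tendsto_const])
    then show ?thesis using True by (simp add: \<phi>_def)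
  next
    case False
    then have "\<psi> x = 0" using pos[of x] \<psi>01[of x] by linarith
    then show ?thesis using False by (simp add: \<phi>_def)
  qed
  ultimately show ?thesis using that by blast
qed

lemma signed_integral_limit:
  assumes \<mu>: "signed_measure_on M \<mu>"
    and \<phi>: "\<And>n. \<phi> n \<in> borel_measurable M" "\<And>n x. \<bar>\<phi> n x\<bar> \<le> B"
    and lim: "\<And>x. x \<in> space M \<Longrightarrow> (\<lambda>n::nat. \<phi> n x) \<longlonglongrightarrow> \<psi> x"
  shows "(\<lambda>n. signed_integral M \<mu> (\<phi> n)) \<longlonglongrightarrow> signed_integral M \<mu> \<psi>"
  unfolding signed_integral_def
proof (rule integral_dominated_convergence[where w="\<lambda>x. B * \<bar>polar_density M \<mu> x\<bar>"])
  let ?T = "total_variation M \<mu>" and ?\<sigma> = "polar_density M \<mu>"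
  have int: "integrable ?T ?\<sigma>" using has_density_onD(3)[OF polar_density(1)[OF \<mu>]] .
  then have [measurable]: "?\<sigma> \<in> borel_measurable M"
    using borel_measurable_integrable measurable_cong_sets[OF sets_total_variation refl] by blast
  note \<phi>(1)[measurable]
  have [measurable]: "\<psi> \<in> borel_measurable M"
    by (rule borel_measurable_LIMSEQ_real[OF lim \<phi>(1)])
  show "(\<lambda>x. \<psi> x * ?\<sigma> x) \<in> borel_measurable ?T" by measurable
  show "(\<lambda>x. \<phi> n x * ?\<sigma> x) \<in> borel_measurable ?T" for n by measurable
  show "integrable ?T (\<lambda>x. B * \<bar>?\<sigma> x\<bar>)" using int by auto
  show "AE x in ?T. (\<lambda>n. \<phi> n x * ?\<sigma> x) \<longlonglongrightarrow> \<psi> x * ?\<sigma> x"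
    using lim by (intro AE_I2 tendsto_mult_right) simp
  show "AE x in ?T. norm (\<phi> n x * ?\<sigma> x) \<le> B * \<bar>?\<sigma> x\<bar>" for n
    using \<phi>(2) by (intro AE_I2) (auto simp: abs_mult intro!: mult_right_mono)
qed

lemma signed_integral_indicator:
  assumes \<mu>: "signed_measure_on M \<mu>" and A: "A \<in> sets M"
  shows "signed_integral M \<mu> (indicator A) = \<mu> A"
  using has_density_onD(4)[OF polar_density(1)[OF \<mu>] A]
  by (simp add: signed_integral_def set_lebesgue_integral_def)

text \<open>Test functions determine a signed measure on intervals compactly contained in \<open>(0,1)\<close>, by
  dominated convergence; hence on all intervals, and hence on all Borel sets because the intervals
  form a generator stable under intersection.\<close>

lemma derivative_measure_unique:
  assumes 1: "is_derivative_measure v \<mu>" and 2: "is_derivative_measure v \<nu>" and A: "A \<in> sets borel01"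
  shows "\<mu> A = \<nu> A"
proof -
  have s: "signed_measure_on borel01 \<mu>" "signed_measure_on borel01 \<nu>"
    using 1 2 by (auto simp: is_derivative_measure_def)
  have test: "signed_integral borel01 \<mu> \<phi> = signed_integral borel01 \<nu> \<phi>" if "test_function \<phi>" for \<phi>
    using 1 2 that by (auto simp: is_derivative_measure_def)
  have interval_inside: "\<mu> {c<..<d} = \<nu> {c<..<d}" if cd: "0 < c" "d < 1" for c d :: real
  proof -
    obtain \<phi> :: "nat \<Rightarrow> real \<Rightarrow> real" where \<phi>: "\<And>n. test_function (\<phi> n)" "\<And>n x. \<bar>\<phi> n x\<bar> \<le> 1"
      "\<And>x. (\<lambda>n. \<phi> n x) \<longlonglongrightarrow> indicator {c<..<d} x"
      using indicator_limit_test_functions[OF cd] by blast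
    have lim: "(\<lambda>n. signed_integral borel01 \<rho> (\<phi> n)) \<longlonglongrightarrow> \<rho> {c<..<d}"
      if "signed_measure_on borel01 \<rho>" for \<rho>
    proof -
      have "{c<..<d} \<in> sets borel01" using cd by (auto simp: sets_borel01)
      then show ?thesis
        using signed_integral_limit[OF that test_function_measurable(1)[OF \<phi>(1)] \<phi>(2,3)]
        by (simp add: signed_integral_indicator[OF that])
    qed
    have "signed_integral borel01 \<mu> (\<phi> n) = signed_integral borel01 \<nu> (\<phi> n)" for n
      by (rule test[OF \<phi>(1)])
    then show ?thesis using lim[OF s(1)] lim[OF s(2)] LIMSEQ_unique by simp
  qed
  have interval: "\<mu> (I01 \<inter> {c<..<d}) = \<nu> (I01 \<inter> {c<..<d})" for c d :: real
  proof -
    define J where "J n = {max c (1 / real (n + 2))<..<min d (1 - 1 / real (n + 2))}" for n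
    have J: "J n \<in> sets borel01" for n
    proof -
      have "0 < 1 / real (n + 2)" by simp
      then have "J n \<subseteq> I01"
        unfolding J_def greaterThanLessThan_subseteq_greaterThanLessThan by linarith
      then show ?thesis by (simp add: J_def sets_borel01)
    qed
    have lim: "(\<lambda>n. \<rho> (J n)) \<longlonglongrightarrow> \<rho> (I01 \<inter> {c<..<d})" if \<rho>: "signed_measure_on borel01 \<rho>" for \<rho>
    proof -
      have "(\<lambda>n. indicator (J n) x :: real) \<longlonglongrightarrow> indicator (I01 \<inter> {c<..<d}) x" if "x \<in> space borel01" for x
      proof -
        have x: "0 < x" "x < 1" using that by auto
        have "(\<lambda>n. 1 / real (n + 2)) \<longlonglongrightarrow> 0" using lim_const_over_n[of 1, THEN LIMSEQ_ignore_initial_segment] .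
        then have "\<forall>\<^sub>F n in sequentially. 1 / real (n + 2) < min x (1 - x)"
          by (rule order_tendstoD) (use x in auto)
        then have "\<forall>\<^sub>F n in sequentially. indicator (J n) x = (indicator (I01 \<inter> {c<..<d}) x :: real)"
          by eventually_elim (use x in \<open>auto simp: J_def indicator_def\<close>)
        then show ?thesis by (rule tendsto_eventually)
      qed
      then have "(\<lambda>n. signed_integral borel01 \<rho> (indicator (J n))) \<longlonglongrightarrow> signed_integral borel01 \<rho> (indicator (I01 \<inter> {c<..<d}))"
        by (intro signed_integral_limit[OF \<rho>, where B=1]) (use J in \<open>auto simp: indicator_def\<close>)
      moreover have "I01 \<inter> {c<..<d} \<in> sets borel01" by (auto simp: sets_borel01)
      ultimately show ?thesis using J by (simp add: signed_integral_indicator[OF \<rho>])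
    qed
    have "\<mu> (J n) = \<nu> (J n)" for n
    proof -
      have "0 < 1 / real (n + 2)" by simp
      then show ?thesis unfolding J_def by (intro interval_inside) linarith+
    qed
    then show ?thesis using lim[OF s(1)] lim[OF s(2)] LIMSEQ_unique by simp
  qed
  have "I01 \<inter> {-1<..<2} = I01" by auto
  then have whole: "\<mu> I01 = \<nu> I01" using interval[of "-1" 2] by simp
  define G where "G = range (\<lambda>(a, b). {a<..<b::real})"
  have sets_G: "sets borel = sigma_sets UNIV G"
    using arg_cong[OF borel_eq_box[where 'a=real], of sets] by (simp add: G_def box_real del: sets_borel)
  have GU: "G \<subseteq> Pow UNIV" by simp
  have "Int_stable G"
  proof (rule Int_stableI)
    fix a b assume "a \<in> G" "b \<in> G"
    then obtain c d c' d' where "a = {c<..<d}" "b = {c'<..<d'}"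
      unfolding G_def by auto
    then show "a \<inter> b \<in> G"
      unfolding G_def by (intro image_eqI[of _ _ "(max c c', min d d')"]) auto
  qed
  moreover have "A \<in> sigma_sets UNIV G" "I01 \<inter> A = A" using A sets_G by (auto simp: sets_borel01)
  moreover have "\<mu> (I01 \<inter> B) = \<nu> (I01 \<inter> B)" if "B \<in> sigma_sets UNIV G" for B
    using \<open>Int_stable G\<close> GU that
  proof (induction rule: sigma_sets_induct_disjoint)
    case (basic B)
    then show ?case using interval by (auto simp: G_def)
  next
    case empty
    then show ?case using s by (simp add: signed_measure_on_empty)
  next
    case (compl B)
    then have "B \<in> sets borel" using sets_G by simp
    then have B: "I01 \<inter> B \<in> sets borel01" by (simp add: sets_borel01)
    have "I01 \<in> sets borel01" "I01 \<inter> (I01 \<inter> B) = I01 \<inter> B" "I01 \<inter> (UNIV - B) = I01 - (I01 \<inter> B)"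
      by (auto simp: sets_borel01)
    then have co: "\<rho> (I01 \<inter> (UNIV - B)) = \<rho> I01 - \<rho> (I01 \<inter> B)" if "signed_measure_on borel01 \<rho>" for \<rho>
      using signed_measure_on_split[OF that _ B, of I01] by simp
    then show ?case using co[OF s(1)] co[OF s(2)] compl(2) whole by simp
  next
    case (union B)
    have "range B \<subseteq> sets borel" using union(2) sets_G by simp
    then have "range (\<lambda>i. I01 \<inter> B i) \<subseteq> sets borel01" by (auto simp: sets_borel01)
    moreover have "disjoint_family (\<lambda>i. I01 \<inter> B i)" using union(1) by (auto simp: disjoint_family_on_def)
    ultimately have un: "(\<lambda>i. \<rho> (I01 \<inter> B i)) sums \<rho> (I01 \<inter> (\<Union>i. B i))" if "signed_measure_on borel01 \<rho>" for \<rho>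
      using signed_measure_on_sums[OF that, of "\<lambda>i. I01 \<inter> B i"] by (simp only: Int_UN_distrib)
    show ?case
      using un[OF s(1)] un[OF s(2)] unfolding union(3) by (rule sums_unique2)
  qed
  ultimately show ?thesis by metis
qed

section \<open>Primitives and their derivative measures\<close>

text \<open>Since \<open>T\<close> may have atoms, the choice of the closed condition \<open>t \<le> x\<close> makes this the
  right-continuous primitive of the measure with density \<open>s\<close> with respect to \<open>T\<close>.\<close>

definition primitive :: "real measure \<Rightarrow> (real \<Rightarrow> real) \<Rightarrow> real \<Rightarrow> real" where
  "primitive T s x = (LINT t|T. (if t \<le> x then 1 else 0) * s t)"

text \<open>Fubini on the triangle \<open>t \<le> x\<close>. This is the only form of integration by parts that the proof
  uses: against derivatives of test functions it identifies the derivative of a primitive, and in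
  the weak formulation it moves the primitive from the test function to the right-hand side.\<close>

lemma integral_primitive_swap:
  fixes s w :: "real \<Rightarrow> real"
  assumes T: "sigma_finite_measure T" "space T = I01" "sets borel01 \<subseteq> sets T" "integrable T s"
    and S: "sigma_finite_measure S" "space S = I01" "sets borel01 \<subseteq> sets S" "integrable S w"
  shows "primitive T s \<in> borel_measurable S"
    and "(LINT x|S. primitive T s x * w x) =
      (LINT t|T. s t * (LINT x|S. (if t \<le> x then 1 else 0) * w x))"
proof -
  interpret T: sigma_finite_measure T by fact
  interpret S: sigma_finite_measure S by fact
  interpret TS: pair_sigma_finite T S ..
  have id: "(\<lambda>x. x) \<in> borel_measurable borel01" by (rule measurable_borel01) simp
  have [measurable]: "(\<lambda>x. x) \<in> borel_measurable T" "(\<lambda>x. x) \<in> borel_measurable S"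
    by (rule measurable_larger_sets[OF _ _ id]; use T S in simp)+
  have [measurable]: "s \<in> borel_measurable T" "w \<in> borel_measurable S"
    using T(4) S(4) by auto
  have [measurable]: "fst \<in> borel_measurable (T \<Otimes>\<^sub>M S)" "snd \<in> borel_measurable (T \<Otimes>\<^sub>M S)"
    using measurable_compose[OF measurable_fst \<open>(\<lambda>x. x) \<in> borel_measurable T\<close>]
      measurable_compose[OF measurable_snd \<open>(\<lambda>x. x) \<in> borel_measurable S\<close>] by auto
  have [measurable]: "fst \<in> borel_measurable (S \<Otimes>\<^sub>M T)" "snd \<in> borel_measurable (S \<Otimes>\<^sub>M T)"
    using measurable_compose[OF measurable_fst \<open>(\<lambda>x. x) \<in> borel_measurable S\<close>]
      measurable_compose[OF measurable_snd \<open>(\<lambda>x. x) \<in> borel_measurable T\<close>] by auto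
  have meas: "(\<lambda>p. (if fst p \<le> snd p then 1 else 0) * s (fst p) * w (snd p)) \<in> borel_measurable (T \<Otimes>\<^sub>M S)"
    by measurable
  have "(\<lambda>p. (if snd p \<le> fst p then 1 else 0) * s (snd p)) \<in> borel_measurable (S \<Otimes>\<^sub>M T)"
    by measurable
  then show "primitive T s \<in> borel_measurable S"
    unfolding primitive_def[abs_def]
    by (intro T.borel_measurable_lebesgue_integral) (simp add: split_beta')
  have row: "integrable S (\<lambda>x. (if t \<le> x then 1 else 0) * w x)" if "t \<in> space T" for t
    by (rule integrable_bounded_mult[where B=1]) (use S(4) in auto)
  have bound: "(LINT x|S. norm ((if t \<le> x then 1 else 0) * w x)) \<le> (LINT x|S. \<bar>w x\<bar>)" if "t \<in> space T" for t
    by (rule integral_mono) (use row[OF that] S(4) in auto)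
  have int: "integrable (T \<Otimes>\<^sub>M S) (\<lambda>(t, x). (if t \<le> x then 1 else 0) * s t * w x)"
    unfolding split_beta'
  proof (rule TS.Fubini_integrable[OF meas])
    show "integrable T (\<lambda>t. LINT x|S. norm ((if fst (t, x) \<le> snd (t, x) then 1 else 0) * s (fst (t, x)) * w (snd (t, x))))"
    proof (rule Bochner_Integration.integrable_bound)
      show "integrable T (\<lambda>t. \<bar>s t\<bar> * (LINT x|S. \<bar>w x\<bar>))" using T(4) by auto
      show "(\<lambda>t. LINT x|S. norm ((if fst (t, x) \<le> snd (t, x) then 1 else 0) * s (fst (t, x)) * w (snd (t, x)))) \<in> borel_measurable T"
        by (rule S.borel_measurable_lebesgue_integral) (use meas in \<open>simp add: split_beta'\<close>)
      show "AE t in T. norm (LINT x|S. norm ((if fst (t, x) \<le> snd (t, x) then 1 else 0) * s (fst (t, x)) * w (snd (t, x))))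
          \<le> norm (\<bar>s t\<bar> * (LINT x|S. \<bar>w x\<bar>))"
      proof (rule AE_I2)
        fix t assume t: "t \<in> space T"
        have "(LINT x|S. norm ((if t \<le> x then 1 else 0) * s t * w x)) = \<bar>s t\<bar> * (LINT x|S. norm ((if t \<le> x then 1 else 0) * w x))"
          unfolding Bochner_Integration.integral_mult_right_zero[symmetric]
          by (rule Bochner_Integration.integral_cong) (auto simp: abs_mult)
        also have "\<dots> \<le> \<bar>s t\<bar> * (LINT x|S. \<bar>w x\<bar>)"
          using bound[OF t] by (rule mult_left_mono) simp
        finally show "norm (LINT x|S. norm ((if fst (t, x) \<le> snd (t, x) then 1 else 0) * s (fst (t, x)) * w (snd (t, x))))
          \<le> norm (\<bar>s t\<bar> * (LINT x|S. \<bar>w x\<bar>))" by simp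
      qed
    qed
    show "AE t in T. integrable S (\<lambda>x. (if fst (t, x) \<le> snd (t, x) then 1 else 0) * s (fst (t, x)) * w (snd (t, x)))"
    proof (rule AE_I2)
      fix t assume t: "t \<in> space T"
      have "integrable S (\<lambda>x. s t * ((if t \<le> x then 1 else 0) * w x))" using row[OF t] by auto
      then show "integrable S (\<lambda>x. (if fst (t, x) \<le> snd (t, x) then 1 else 0) * s (fst (t, x)) * w (snd (t, x)))"
        by (simp add: ac_simps)
    qed
  qed
  have "(LINT x|S. primitive T s x * w x) =
    (LINT x|S. (LINT t|T. (if t \<le> x then 1 else 0) * s t * w x))"
    by (simp add: primitive_def)
  also have "\<dots> = (LINT t|T. (LINT x|S. (if t \<le> x then 1 else 0) * s t * w x))"
    by (rule TS.Fubini_integral[OF int])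
  also have "\<dots> = (LINT t|T. s t * (LINT x|S. (if t \<le> x then 1 else 0) * w x))"
    by (subst Bochner_Integration.integral_mult_right_zero[symmetric]) (simp add: ac_simps)
  finally show "(LINT x|S. primitive T s x * w x) =
      (LINT t|T. s t * (LINT x|S. (if t \<le> x then 1 else 0) * w x))" .
qed

lemma primitive_bound:
  fixes s :: "real \<Rightarrow> real"
  assumes "integrable T s"
  shows "\<bar>primitive T s x\<bar> \<le> (LINT t|T. \<bar>s t\<bar>)"
proof -
  have "\<bar>primitive T s x\<bar> \<le> (LINT t|T. \<bar>(if t \<le> x then 1 else 0) * s t\<bar>)"
    unfolding primitive_def by (rule integral_abs_bound)
  also have "\<dots> \<le> (LINT t|T. \<bar>s t\<bar>)"
    by (rule integral_mono') (use assms in auto)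
  finally show ?thesis .
qed

text \<open>The source of all test functions of the weak formulation: any signed measure with a density is
  the derivative of a function of bounded variation.\<close>

lemma primitive_derivative_measure:
  fixes s :: "real \<Rightarrow> real"
  assumes T: "sigma_finite_measure T" and d: "has_density_on borel01 \<mu> T s"
    and v: "\<And>x. x \<in> I01 \<Longrightarrow> v x = c + primitive T s x"
  shows "integrable leb01 v" "is_derivative_measure v \<mu>"
proof -
  note D = has_density_onD[OF d]
  interpret L: finite_measure leb01 by (rule finite_measure_leb01)
  have L: "sigma_finite_measure leb01" ..
  have prim_meas: "primitive T s \<in> borel_measurable leb01"
    by (rule integral_primitive_swap(1)[where w="\<lambda>_. 0", OF T _ D(2,3) L]) (use D(1) sets_borel01_leb01 in auto)
  have prim_int: "integrable leb01 (primitive T s)"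
    using primitive_bound[OF D(3)] prim_meas
    by (intro L.integrable_const_bound[where B="LINT t|T. \<bar>s t\<bar>"]) auto
  have "integrable leb01 (\<lambda>x. c + primitive T s x)" using prim_int by auto
  then show "integrable leb01 v"
    by (subst Bochner_Integration.integrable_cong[OF refl, where g="\<lambda>x. c + primitive T s x"]) (auto simp: v)
  show "is_derivative_measure v \<mu>"
    unfolding is_derivative_measure_def
  proof (intro conjI allI impI)
    show "signed_measure_on borel01 \<mu>" by (rule signed_measure_on_density[OF d])
    fix \<phi> assume \<phi>: "test_function \<phi>"
    obtain B where B: "\<And>x. \<bar>\<phi> x\<bar> \<le> B" "\<And>x. x \<in> I01 \<Longrightarrow> \<bar>deriv \<phi> x\<bar> \<le> B"
      using test_function_bounds[OF \<phi>] by blast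
    have m: "deriv \<phi> \<in> borel_measurable leb01"
      by (rule measurable_larger_sets[OF _ sets_borel01_leb01 test_function_measurable(2)[OF \<phi>]]) simp
    have i: "integrable leb01 (deriv \<phi>)"
      using B(2) m by (intro L.integrable_const_bound[where B=B]) auto
    have i0: "integrable leb01 (\<lambda>x. primitive T s x * deriv \<phi> x)"
      using primitive_bound[OF D(3)] by (intro integrable_bounded_mult[OF i prim_meas]) auto
    have z: "(LINT x|leb01. deriv \<phi> x) = 0"
    proof -
      have "(LINT x|leb01. deriv \<phi> x) = (LINT x|leb01. (if 0 \<le> x then 1 else 0) * deriv \<phi> x)"
        by (rule Bochner_Integration.integral_cong) auto
      also have "\<dots> = 0"
        using integral_deriv_test_function[OF \<phi>, of 0] test_functionD(4)[OF \<phi>, of 0] by simp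
      finally show ?thesis .
    qed
    have "(LINT x|leb01. v x * deriv \<phi> x) = (LINT x|leb01. c * deriv \<phi> x + primitive T s x * deriv \<phi> x)"
      by (rule Bochner_Integration.integral_cong) (auto simp: v distrib_right)
    also have "\<dots> = c * (LINT x|leb01. deriv \<phi> x) + (LINT x|leb01. primitive T s x * deriv \<phi> x)"
      using i i0 by (simp add: Bochner_Integration.integral_add)
    also have "(LINT x|leb01. primitive T s x * deriv \<phi> x) = (LINT t|T. s t * (LINT x|leb01. (if t \<le> x then 1 else 0) * deriv \<phi> x))"
      by (rule integral_primitive_swap(2)[OF T _ D(2,3) L _ _ i]) (use D(1) sets_borel01_leb01 in auto)
    also have "\<dots> = (LINT t|T. - (\<phi> t * s t))"
      using D(1) by (intro Bochner_Integration.integral_cong) (auto simp: integral_deriv_test_function[OF \<phi>])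
    also have "\<dots> = - signed_integral borel01 \<mu> \<phi>"
      using signed_integral_density[OF d test_function_measurable(1)[OF \<phi>] B(1)] by simp
    finally show "(LINT x|leb01. v x * deriv \<phi> x) = - signed_integral borel01 \<mu> \<phi>"
      using z by simp
  qed
qed

section \<open>The Lebesgue decomposition of a signed measure\<close>

lemma has_density_on_leb01:
  "integrable leb01 g \<Longrightarrow> has_density_on borel01 (\<lambda>A. LINT x:A|leb01. g x) leb01 g"
  unfolding has_density_on_def using sets_borel01_leb01 by auto

text \<open>A Lebesgue measurable sign agrees almost everywhere with a Borel function, so Borel sets
  suffice to separate densities.\<close>

lemma leb01_density_AE_unique:
  fixes g g' :: "real \<Rightarrow> real"
  assumes g: "integrable leb01 g" "integrable leb01 g'"
    and eq: "\<And>A. A \<in> sets borel01 \<Longrightarrow> (LINT x:A|leb01. g x) = (LINT x:A|leb01. g' x)"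
  shows "AE x in leb01. g x = g' x"
proof -
  let ?\<mu> = "\<lambda>A. LINT x:A|leb01. g x"
  have d: "has_density_on borel01 ?\<mu> leb01 g" "has_density_on borel01 ?\<mu> leb01 g'"
    using has_density_on_leb01[OF g(1)] has_density_on_leb01[OF g(2)] eq by (auto simp: has_density_on_def)
  have "(\<lambda>x. sgn (g x - g' x)) \<in> borel_measurable leb01" using g by auto
  then have "(\<lambda>x. sgn (g x - g' x) * indicator I01 x) \<in> borel_measurable lebesgue"
    by (subst (asm) borel_measurable_restrict_space_iff) (auto simp: mult.commute)
  then obtain \<sigma> where \<sigma>: "\<sigma> \<in> borel_measurable lborel" "AE x in lborel. sgn (g x - g' x) * indicator I01 x = \<sigma> x"
    using completion_ex_borel_measurable_real by blast
  have "AE x in lebesgue. sgn (g x - g' x) * indicator I01 x = \<sigma> x"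
    using \<sigma>(2) by (rule AE_completion)
  then have "AE x in leb01. \<sigma> x = sgn (g x - g' x)"
    by (subst AE_restrict_space_iff) (auto elim: AE_mp)
  moreover have "\<sigma> \<in> borel_measurable borel01" using \<sigma>(1) by (intro measurable_borel01) simp
  ultimately show ?thesis using density_AE_unique[OF d] by blast
qed

lemma total_variation_null_subset:
  assumes \<nu>: "signed_measure_on M \<nu>" and A: "emeasure (total_variation M \<nu>) A = 0" "A \<in> sets M"
    and B: "B \<in> sets M" "B \<subseteq> A"
  shows "\<nu> B = 0"
proof -
  let ?T = "total_variation M \<nu>"
  have "emeasure ?T B \<le> emeasure ?T A" using B A by (intro emeasure_mono) auto
  then have "B \<in> null_sets ?T" using A B by (auto simp: null_sets_def)
  then have "AE x in ?T. x \<notin> B" by (rule AE_not_in)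
  then have "AE x in ?T. indicator B x *\<^sub>R polar_density M \<nu> x = 0" by eventually_elim simp
  then have "(LINT x|?T. indicator B x *\<^sub>R polar_density M \<nu> x) = 0"
    by (rule integral_eq_zero_AE)
  then show ?thesis
    using has_density_onD(4)[OF polar_density(1)[OF \<nu>] B(1)]
    by (simp add: set_lebesgue_integral_def)
qed

lemma null_lborel_leb01:
  assumes "N \<in> sets borel01" "emeasure lborel N = 0"
  shows "AE x in leb01. x \<notin> N"
proof -
  have "N \<in> null_sets lborel" using assms by (auto simp: null_sets_def sets_borel01)
  then have "AE x in lebesgue. x \<notin> N" by (intro AE_completion AE_not_in)
  then show ?thesis by (subst AE_restrict_space_iff) auto
qed

text \<open>On the union of the two null sets that carry the singular parts, the absolutely continuous parts
  vanish, so there the singular parts are the whole measure; off this union they vanish.\<close>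

lemma lebesgue_decomposition_unique:
  assumes 1: "lebesgue_decomposition \<mu> g \<nu>" and 2: "lebesgue_decomposition \<mu>' g' \<nu>'"
    and eq: "\<And>A. A \<in> sets borel01 \<Longrightarrow> \<mu> A = \<mu>' A"
  shows "AE x in leb01. g x = g' x" "\<And>A. A \<in> sets borel01 \<Longrightarrow> \<nu> A = \<nu>' A"
proof -
  obtain N where N: "N \<in> sets borel01" "emeasure lborel N = 0"
    "emeasure (total_variation borel01 \<nu>) (I01 - N) = 0"
    using 1 by (auto simp: lebesgue_decomposition_def)
  obtain N' where N': "N' \<in> sets borel01" "emeasure lborel N' = 0"
    "emeasure (total_variation borel01 \<nu>') (I01 - N') = 0"
    using 2 by (auto simp: lebesgue_decomposition_def)
  have s: "signed_measure_on borel01 \<nu>" "signed_measure_on borel01 \<nu>'"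
    using 1 2 by (auto simp: lebesgue_decomposition_def)
  define K where "K = N \<union> N'"
  have K: "K \<in> sets borel01" using N N' by (simp add: K_def)
  have AEK: "AE x in leb01. x \<notin> K"
    using null_lborel_leb01[OF N(1,2)] null_lborel_leb01[OF N'(1,2)] unfolding K_def
    by eventually_elim auto
  have IK: "I01 - N \<in> sets borel01" "I01 - N' \<in> sets borel01"
    using N(1) N'(1) by (auto simp: sets_borel01)
  have onK: "\<rho> A = \<rho> (A \<inter> K)" if "signed_measure_on borel01 \<rho>"
    "emeasure (total_variation borel01 \<rho>) (I01 - N0) = 0" "I01 - N0 \<in> sets borel01" "N0 \<subseteq> K" "A \<in> sets borel01" for \<rho> A N0
  proof -
    have "\<rho> (A - K) = 0"
      by (rule total_variation_null_subset[OF that(1,2,3)]) (use that K in \<open>auto simp: sets_borel01\<close>)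
    then show ?thesis using signed_measure_on_split[OF that(1,5) K] by simp
  qed
  have zero: "(LINT x:A \<inter> K|leb01. f x) = 0" for A and f :: "real \<Rightarrow> real"
    unfolding set_lebesgue_integral_def
    by (rule integral_eq_zero_AE) (use AEK in \<open>eventually_elim, simp\<close>)
  show sing: "\<nu> A = \<nu>' A" if A: "A \<in> sets borel01" for A
  proof -
    have AK: "A \<inter> K \<in> sets borel01" using A K by simp
    have "\<nu> A = \<nu> (A \<inter> K)" by (rule onK[OF s(1) N(3) IK(1) _ A]) (simp add: K_def)
    also have "\<dots> = \<mu> (A \<inter> K)" using 1 AK zero[of A g] by (auto simp: lebesgue_decomposition_def)
    also have "\<dots> = \<mu>' (A \<inter> K)" by (rule eq[OF AK])
    also have "\<dots> = \<nu>' (A \<inter> K)" using 2 AK zero[of A g'] by (auto simp: lebesgue_decomposition_def)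
    also have "\<dots> = \<nu>' A" by (rule onK[OF s(2) N'(3) IK(2) _ A, symmetric]) (simp add: K_def)
    finally show ?thesis .
  qed
  show "AE x in leb01. g x = g' x"
  proof (rule leb01_density_AE_unique)
    show "integrable leb01 g" "integrable leb01 g'" using 1 2 by (auto simp: lebesgue_decomposition_def)
    fix A assume A: "A \<in> sets borel01"
    have "\<mu> A = (LINT x:A|leb01. g x) + \<nu> A" "\<mu>' A = (LINT x:A|leb01. g' x) + \<nu>' A"
      using 1 2 A by (auto simp: lebesgue_decomposition_def)
    then show "(LINT x:A|leb01. g x) = (LINT x:A|leb01. g' x)" using eq[OF A] sing[OF A] by simp
  qed
qed

text \<open>A union of null sets whose \<open>T\<close>-measures approach the supremum is itself a null set and attains
  the supremum. No null set outside it can then have positive \<open>T\<close>-measure.\<close>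

lemma maximal_null_set:
  assumes "finite_measure T" and T: "space T = space M" "sets T = sets M"
  obtains N where "N \<in> null_sets M"
    "\<And>A. A \<in> null_sets M \<Longrightarrow> emeasure T (A - N) = 0"
proof -
  interpret finite_measure T by fact
  define V where "V = measure T ` null_sets M"
  have bdd: "bdd_above V"
    unfolding V_def by (rule bdd_aboveI[of _ "measure T (space T)"]) (auto intro: bounded_measure)
  have ne: "V \<noteq> {}" unfolding V_def by blast
  have "\<exists>N\<in>null_sets M. Sup V - 1 / real (Suc n) < measure T N" for n
    using less_cSupD[OF ne, of "Sup V - 1 / real (Suc n)"] by (auto simp: V_def)
  then obtain N where N: "\<And>n. N n \<in> null_sets M" "\<And>n. Sup V - 1 / real (Suc n) < measure T (N n)" by metis
  define K where "K = (\<Union>n. N n)"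
  have K: "K \<in> null_sets M" using N(1) by (auto simp: K_def)
  have "Sup V - 1 / real (Suc n) \<le> measure T K" for n
  proof -
    have "measure T (N n) \<le> measure T K"
      using K T(2) by (intro finite_measure_mono) (auto simp: K_def)
    then show ?thesis using N(2)[of n] by simp
  qed
  then have "Sup V - 0 \<le> measure T K"
    by (intro LIMSEQ_le_const2[OF tendsto_diff[OF tendsto_const LIMSEQ_Suc[OF lim_const_over_n[of 1]]]]) auto
  moreover have "emeasure T (A - K) = 0" if A: "A \<in> null_sets M" and "Sup V \<le> measure T K" for A
  proof -
    have "A \<union> K \<in> null_sets M" using A K by auto
    then have "measure T (A \<union> K) \<le> Sup V" unfolding V_def by (intro cSup_upper bdd[unfolded V_def]) auto
    moreover have "measure T (A \<union> K) = measure T (A - K) + measure T K"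
      using A K T(2) by (subst finite_measure_Union[symmetric]) auto
    ultimately have "measure T (A - K) \<le> 0" using that(2) by simp
    then show ?thesis by (simp add: emeasure_eq_measure measure_le_0_iff)
  qed
  ultimately show ?thesis using that[OF K] by auto
qed

text \<open>Take a Lebesgue null set \<open>N\<close> of maximal total variation. Off \<open>N\<close> the total variation does not
  charge Lebesgue null sets, so Radon-Nikodym gives it a density there; the singular part is the
  restriction of \<open>\<mu>\<close> to \<open>N\<close>.\<close>

lemma lebesgue_decomposition_exists:
  assumes \<mu>: "signed_measure_on borel01 \<mu>"
  shows "\<exists>g \<nu>. lebesgue_decomposition \<mu> g \<nu>"
proof -
  let ?T = "total_variation borel01 \<mu>" and ?\<sigma> = "polar_density borel01 \<mu>"
  let ?L = "restrict_space lborel I01"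
  interpret T: finite_measure ?T by (rule finite_measure_total_variation[OF \<mu>])
  note D = has_density_onD[OF polar_density(1)[OF \<mu>]]
  have sL[measurable_cong]: "sets ?L = sets borel01" by (rule sets_restrict_space_cong) simp
  interpret L: finite_measure ?L
    by (rule finite_measureI) (simp add: emeasure_restrict_space space_restrict_space)
  obtain N where N: "N \<in> null_sets ?L" and max: "\<And>A. A \<in> null_sets ?L \<Longrightarrow> emeasure ?T (A - N) = 0"
    using maximal_null_set[OF T.finite_measure_axioms, of ?L] sL by (auto simp: space_restrict_space)
  have Nb: "N \<in> sets borel01" using N sL by auto
  define K where "K = density ?T (indicator (I01 - N))"
  have sK[measurable_cong]: "sets K = sets ?L" by (simp add: K_def sL)
  have [measurable]: "N \<in> sets borel01" by (rule Nb)
  have INb[measurable]: "I01 - N \<in> sets borel01" using Nb by (auto simp: sets_borel01)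
  have eK: "emeasure K A = emeasure ?T (A - N)" if "A \<in> sets borel01" for A
  proof -
    have "(I01 - N) \<inter> A = A - N" using that by (auto simp: sets_borel01)
    then show ?thesis using that INb by (simp add: K_def emeasure_density nn_integral_cmult flip: indicator_inter_arith)
  qed
  interpret K: finite_measure K
    by (rule finite_measureI) (use eK[of I01] in \<open>simp add: K_def sets_borel01\<close>)
  have ac: "absolutely_continuous ?L K"
    unfolding absolutely_continuous_def
  proof
    fix A assume A: "A \<in> null_sets ?L"
    then have "A \<in> sets borel01" using sL by auto
    then show "A \<in> null_sets K" using max[OF A] eK sK sL by (auto simp: null_sets_def)
  qed
  define k where "k x = enn2real (RN_deriv ?L K x)" for x
  note RN = L.RN_deriv_integrable[OF K.sigma_finite_measure_axioms ac sK, folded k_def]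
    L.RN_deriv_integral[OF K.sigma_finite_measure_axioms ac sK, folded k_def]
  have [measurable]: "?\<sigma> \<in> borel_measurable borel01"
    using borel_measurable_integrable[OF D(3)] measurable_cong_sets[OF sets_total_variation refl] by blast
  have km[measurable]: "k \<in> borel_measurable borel01"
  proof -
    have "k \<in> borel_measurable ?L" unfolding k_def[abs_def] by measurable
    then show ?thesis using measurable_cong_sets[OF sL refl] by blast
  qed
  define g where "g x = k x * ?\<sigma> x" for x
  define \<nu> where "\<nu> A = \<mu> (A \<inter> N)" for A
  have intK: "integral\<^sup>L K f = (LINT x|?T. indicator (I01 - N) x * f x)"
    and inK: "integrable K f \<longleftrightarrow> integrable ?T (\<lambda>x. indicator (I01 - N) x * f x)"
    if "f \<in> borel_measurable borel01" for f :: "real \<Rightarrow> real"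
  proof -
    have K': "K = density ?T (\<lambda>x. ennreal (indicator (I01 - N) x))"
      by (simp add: K_def ennreal_indicator)
    have m: "f \<in> borel_measurable ?T" "indicator (I01 - N) \<in> borel_measurable ?T"
      using that INb by (auto cong: measurable_cong_sets)
    show "integral\<^sup>L K f = (LINT x|?T. indicator (I01 - N) x * f x)"
      unfolding K' using m by (subst integral_density) auto
    show "integrable K f \<longleftrightarrow> integrable ?T (\<lambda>x. indicator (I01 - N) x * f x)"
      unfolding K' using m by (subst integrable_density) auto
  qed
  have leb: "integrable leb01 f \<longleftrightarrow> integrable ?L f" "integral\<^sup>L leb01 f = integral\<^sup>L ?L f"
    if "f \<in> borel_measurable borel01" for f :: "real \<Rightarrow> real"
    using integrable_leb01_borel[OF that] by (simp_all add: integrable_restrict_space integral_restrict_space)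
  have "lebesgue_decomposition \<mu> g \<nu>"
    unfolding lebesgue_decomposition_def
  proof (intro conjI bexI[of _ N] ballI)
    have "integrable K ?\<sigma>"
      using integrable_real_mult_indicator[OF _ D(3), of "I01 - N"] INb inK[of ?\<sigma>] by (simp add: mult.commute)
    then have "integrable ?L g"
      using RN(1)[of ?\<sigma>] by (simp add: g_def[abs_def])
    then show "integrable leb01 g" by (subst leb(1)) (auto simp: g_def[abs_def])
    have "has_density_on borel01 \<nu> ?T (\<lambda>x. indicator N x *\<^sub>R ?\<sigma> x)"
      unfolding has_density_on_def
    proof (intro conjI ballI)
      show "integrable ?T (\<lambda>x. indicator N x *\<^sub>R ?\<sigma> x)"
        using D(3) Nb by (intro integrable_mult_indicator) auto
      fix A assume "A \<in> sets borel01"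
      then have "A \<inter> N \<in> sets borel01" using Nb by auto
      then show "\<nu> A = (LINT x:A|?T. indicator N x *\<^sub>R ?\<sigma> x)"
        using D(4) by (simp add: \<nu>_def set_lebesgue_integral_def indicator_inter_arith mult.assoc)
    qed auto
    then show \<nu>: "signed_measure_on borel01 \<nu>" by (rule signed_measure_on_density)
    show "N \<in> sets borel01" by (rule Nb)
    show "emeasure lborel N = 0"
      using N by (subst (asm) null_sets_restrict_space) auto
    show "emeasure (total_variation borel01 \<nu>) (I01 - N) = 0"
    proof (rule emeasure_total_variation_eq_0[OF \<nu> INb])
      fix C assume "C \<subseteq> I01 - N"
      then have "C \<inter> N = {}" by auto
      then show "\<nu> C = 0" using signed_measure_on_empty[OF \<mu>] by (simp add: \<nu>_def)
    qed
    fix A assume A: "A \<in> sets borel01"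
    have [measurable]: "A \<in> sets borel01" by (rule A)
    have AN: "A - N \<in> sets borel01" using A by auto
    have "(LINT x:A|leb01. g x) = (LINT x|?L. k x * (indicator A x * ?\<sigma> x))"
      unfolding set_lebesgue_integral_def by (subst leb(2)) (auto simp: g_def[abs_def] ac_simps)
    also have "\<dots> = (LINT x|K. indicator A x * ?\<sigma> x)"
      by (rule RN(2)[symmetric]) measurable
    also have "\<dots> = (LINT x:A - N|?T. ?\<sigma> x)"
      unfolding set_lebesgue_integral_def
      by (subst intK) (use A in \<open>auto intro!: Bochner_Integration.integral_cong simp: indicator_def sets_borel01\<close>)
    also have "\<dots> = \<mu> (A - N)" using D(4)[OF AN] by simp
    finally show "\<mu> A = (LINT x:A|leb01. g x) + \<nu> A"
      using signed_measure_on_split[OF \<mu> A Nb] by (simp add: \<nu>_def)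
  qed
  then show ?thesis by blast
qed

section \<open>The two parts of the derivative\<close>

lemma is_derivative_measure_deriv_measure:
  "v \<in> BV01 \<Longrightarrow> is_derivative_measure v (deriv_measure v)"
  unfolding BV01_def deriv_measure_def using someI_ex[of "is_derivative_measure v"] by simp

lemma lebesgue_decomposition_deriv:
  assumes "v \<in> BV01"
  shows "lebesgue_decomposition (deriv_measure v) (deriv_ac v) (deriv_sing v)"
proof -
  have "signed_measure_on borel01 (deriv_measure v)"
    using is_derivative_measure_deriv_measure[OF assms] by (simp add: is_derivative_measure_def)
  from lebesgue_decomposition_exists[OF this]
  have "\<exists>p. case p of (g, \<nu>) \<Rightarrow> lebesgue_decomposition (deriv_measure v) g \<nu>" by auto
  from someI_ex[OF this] show ?thesis
    unfolding deriv_ac_def deriv_sing_def by (simp add: case_prod_unfold)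
qed

text \<open>\<^const>\<open>deriv_ac\<close> and \<^const>\<open>deriv_sing\<close> are choices. By the two uniqueness results they can be
  read off from any derivative measure and any decomposition at hand.\<close>

lemma deriv_parts_eq:
  assumes v: "integrable leb01 v" "is_derivative_measure v \<mu>" and dec: "lebesgue_decomposition \<mu> g \<nu>"
  shows "v \<in> BV01" "AE x in leb01. deriv_ac v x = g x" "\<And>A. A \<in> sets borel01 \<Longrightarrow> deriv_sing v A = \<nu> A"
proof -
  show BV: "v \<in> BV01" using v by (auto simp: BV01_def)
  have "deriv_measure v A = \<mu> A" if "A \<in> sets borel01" for A
    by (rule derivative_measure_unique[OF is_derivative_measure_deriv_measure[OF BV] v(2) that])
  from lebesgue_decomposition_unique[OF lebesgue_decomposition_deriv[OF BV] dec this]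
  show "AE x in leb01. deriv_ac v x = g x" "\<And>A. A \<in> sets borel01 \<Longrightarrow> deriv_sing v A = \<nu> A" by auto
qed

lemma weak_deriv_primitive:
  assumes w: "integrable leb01 w" and v: "\<And>x. x \<in> I01 \<Longrightarrow> v x = c + primitive leb01 w x"
  shows "weak_deriv v w"
proof -
  interpret L: finite_measure leb01 by (rule finite_measure_leb01)
  note d = has_density_on_leb01[OF w]
  note P = primitive_derivative_measure[OF L.sigma_finite_measure_axioms d v]
  show ?thesis
    unfolding weak_deriv_def
  proof (intro conjI allI impI)
    fix \<phi> assume \<phi>: "test_function \<phi>"
    obtain B where B: "\<And>x. \<bar>\<phi> x\<bar> \<le> B" "\<And>x. x \<in> I01 \<Longrightarrow> \<bar>deriv \<phi> x\<bar> \<le> B"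
      using test_function_bounds[OF \<phi>] by blast
    have "(LINT x|leb01. v x * deriv \<phi> x) = - signed_integral borel01 (\<lambda>A. LINT x:A|leb01. w x) \<phi>"
      using P(2) \<phi> by (simp add: is_derivative_measure_def)
    then show "(LINT x|leb01. v x * deriv \<phi> x) = - (LINT x|leb01. w x * \<phi> x)"
      using signed_integral_density[OF d test_function_measurable(1)[OF \<phi>] B(1)] by (simp add: mult.commute)
  qed (use P(1) w in auto)
qed

lemma lebesgue_decomposition_ac:
  assumes "integrable leb01 w"
  shows "lebesgue_decomposition (\<lambda>A. LINT x:A|leb01. w x) w (\<lambda>_. 0)"
proof -
  have z: "signed_measure_on borel01 (\<lambda>_. 0)" by (simp add: signed_measure_on_def)
  then have "emeasure (total_variation borel01 (\<lambda>_. 0)) (I01 - {}) = 0"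
    by (intro emeasure_total_variation_eq_0) (auto simp: sets_borel01)
  then show ?thesis
    using assms z by (auto simp: lebesgue_decomposition_def intro!: bexI[of _ "{}"])
qed

lemma lebesgue_decomposition_sing:
  assumes "lebesgue_decomposition \<mu> g \<nu>"
  shows "lebesgue_decomposition \<nu> (\<lambda>_. 0) \<nu>"
  using assms by (auto simp: lebesgue_decomposition_def)

section \<open>Absolutely continuous functions and the chain rule\<close>

lemma primitive_0: "primitive leb01 w 0 = 0"
  unfolding primitive_def by (rule integral_eq_zero_AE) auto

lemma primitive_1: "primitive leb01 w 1 = integral\<^sup>L leb01 w"
  unfolding primitive_def by (rule Bochner_Integration.integral_cong) auto

lemma integrable_indicator_le:
  fixes w :: "real \<Rightarrow> real"
  assumes "integrable leb01 w"
  shows "integrable leb01 (\<lambda>t. (if t \<le> x then 1 else 0) * w t)"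
proof (rule integrable_bounded_mult[OF assms, where B=1])
  have "(\<lambda>t. if t \<le> x then 1 else 0 :: real) \<in> borel_measurable borel01"
    by (rule measurable_borel01) measurable
  then show "(\<lambda>t. if t \<le> x then 1 else 0 :: real) \<in> borel_measurable leb01"
    by (rule measurable_larger_sets[OF _ sets_borel01_leb01, rotated]) simp
qed auto

lemma primitive_diff:
  assumes w: "integrable leb01 w" and "x \<le> y"
  shows "primitive leb01 w y - primitive leb01 w x = (LINT t|leb01. (if x < t \<and> t \<le> y then 1 else 0) * w t)"
    and "integrable leb01 (\<lambda>t. (if x < t \<and> t \<le> y then 1 else 0) * w t)"
proof -
  note i = integrable_indicator_le[OF w]
  have eq: "(if x < t \<and> t \<le> y then 1 else 0) * w t = (if t \<le> y then 1 else 0) * w t - (if t \<le> x then 1 else 0) * w t" for t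
    using assms(2) by auto
  show "primitive leb01 w y - primitive leb01 w x = (LINT t|leb01. (if x < t \<and> t \<le> y then 1 else 0) * w t)"
    unfolding primitive_def eq by (rule Bochner_Integration.integral_diff[symmetric, OF i i])
  show "integrable leb01 (\<lambda>t. (if x < t \<and> t \<le> y then 1 else 0) * w t)"
    unfolding eq by (rule Bochner_Integration.integrable_diff[OF i i])
qed

lemma AE_leb01_neq: "AE t in leb01. t \<noteq> x"
proof -
  have "AE t in lebesgue. t \<noteq> x" by (rule AE_completion[OF AE_lborel_singleton])
  then show ?thesis by (subst AE_restrict_space_iff) auto
qed

text \<open>Lebesgue measure has no atoms.\<close>

lemma continuous_on_primitive:
  assumes w: "integrable leb01 w"
  shows "continuous_on S (primitive leb01 w)"
proof -
  have "isCont (primitive leb01 w) x" for x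
    unfolding continuous_at_sequentially o_def
  proof (intro allI impI)
    fix X :: "nat \<Rightarrow> real" assume X: "X \<longlonglongrightarrow> x"
    show "(\<lambda>n. primitive leb01 w (X n)) \<longlonglongrightarrow> primitive leb01 w x"
      unfolding primitive_def
    proof (rule integral_dominated_convergence[where w="\<lambda>t. \<bar>w t\<bar>"])
      show "(\<lambda>t. (if t \<le> x then 1 else 0) * w t) \<in> borel_measurable leb01"
        "(\<lambda>t. (if t \<le> X n then 1 else 0) * w t) \<in> borel_measurable leb01" for n
        using integrable_indicator_le[OF w] by blast+
      show "integrable leb01 (\<lambda>t. \<bar>w t\<bar>)" using w by auto
      show "AE t in leb01. (\<lambda>n. (if t \<le> X n then 1 else 0) * w t) \<longlonglongrightarrow> (if t \<le> x then 1 else 0) * w t"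
        using AE_leb01_neq[of x]
      proof eventually_elim
        fix t assume "t \<noteq> x"
        then consider "t < x" | "x < t" by linarith
        then have "\<forall>\<^sub>F n in sequentially. (if t \<le> X n then 1 else 0) * w t = (if t \<le> x then 1 else 0) * w t"
        proof cases
          case 1
          then have "\<forall>\<^sub>F n in sequentially. t < X n" using X by (auto intro: order_tendstoD)
          then show ?thesis by eventually_elim (use 1 in auto)
        next
          case 2
          then have "\<forall>\<^sub>F n in sequentially. X n < t" using X by (auto intro: order_tendstoD)
          then show ?thesis by eventually_elim (use 2 in auto)
        qed
        then show "(\<lambda>n. (if t \<le> X n then 1 else 0) * w t) \<longlonglongrightarrow> (if t \<le> x then 1 else 0) * w t"
          by (rule tendsto_eventually)
      qed
      show "AE t in leb01. norm ((if t \<le> X n then 1 else 0) * w t) \<le> \<bar>w t\<bar>" for n by auto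
    qed
  qed
  then show ?thesis by (simp add: continuous_at_imp_continuous_on)
qed

text \<open>The function \<open>F \<circ> G\<close> is only absolutely continuous, so the fundamental theorem of calculus is not
  available pointwise. By the mean value theorem, on a short interval the increment of \<open>F \<circ> G\<close>
  differs from the integral of \<open>F' (G t) * b t\<close> by at most \<open>\<epsilon>\<close> times the integral of \<open>\<bar>b\<bar>\<close>, since
  \<open>F' \<circ> G\<close> is uniformly continuous. These errors add up to at most \<open>\<epsilon>\<close> times the \<open>L\<^sup>1\<close> norm of \<open>b\<close>
  over all of \<open>[0,x]\<close>.\<close>

lemma chain_rule_primitive:
  fixes F F' G b :: "real \<Rightarrow> real"
  assumes b: "integrable leb01 b"
    and G: "\<And>x. x \<in> {0..1} \<Longrightarrow> G x = c + primitive leb01 b x"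
    and r: "\<And>x. x \<in> {0..1} \<Longrightarrow> \<bar>G x\<bar> \<le> r"
    and F: "\<And>y. \<bar>y\<bar> \<le> r \<Longrightarrow> (F has_real_derivative F' y) (at y)"
    and F': "continuous_on {-r..r} F'"
  shows "integrable leb01 (\<lambda>t. F' (G t) * b t)"
    and "x \<in> {0..1} \<Longrightarrow> F (G x) = F (G 0) + primitive leb01 (\<lambda>t. F' (G t) * b t) x"
proof -
  have contG: "continuous_on {0..1} G"
    by (rule continuous_on_eq[where f="\<lambda>x. c + primitive leb01 b x"])
       (auto simp: G intro!: continuous_intros continuous_on_primitive[OF b])
  have Gr: "G x \<in> {-r..r}" if "x \<in> {0..1}" for x using r[OF that] by auto
  have contFG: "continuous_on {0..1} (\<lambda>t. F' (G t))"
    by (rule continuous_on_compose2[OF F' contG]) (use Gr in auto)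
  then have "bounded ((\<lambda>t. F' (G t)) ` {0..1})"
    by (intro compact_imp_bounded compact_continuous_image) auto
  then obtain B where B: "\<forall>t\<in>{0..1}. \<bar>F' (G t)\<bar> \<le> B"
    unfolding bounded_iff by auto
  have "(\<lambda>t. F' (G t)) \<in> borel_measurable leb01"
    by (rule continuous_imp_measurable_on_sets_lebesgue[OF continuous_on_subset[OF contFG]]) auto
  then show int: "integrable leb01 (\<lambda>t. F' (G t) * b t)"
    using B by (intro integrable_bounded_mult[OF b, where B=B]) auto
  define D where "D x = F (G x) - F (G 0) - primitive leb01 (\<lambda>t. F' (G t) * b t) x" for x
  define K where "K = primitive leb01 (\<lambda>t. \<bar>b t\<bar>)"
  have absb: "integrable leb01 (\<lambda>t. \<bar>b t\<bar>)" using b by auto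
  have D0: "D 0 = 0" "K 0 = 0" by (simp_all add: D_def K_def primitive_0)
  have main: "\<bar>D x\<bar> \<le> \<epsilon> * K x" if x: "x \<in> {0..1}" and \<epsilon>: "\<epsilon> > 0" for x \<epsilon>
  proof -
    have "uniformly_continuous_on {-r..r} F'" by (rule compact_uniformly_continuous[OF F']) simp
    then obtain d1 where d1: "d1 > 0"
      "\<And>y y'. y \<in> {-r..r} \<Longrightarrow> y' \<in> {-r..r} \<Longrightarrow> \<bar>y' - y\<bar> < d1 \<Longrightarrow> \<bar>F' y' - F' y\<bar> < \<epsilon>"
      using \<epsilon> unfolding uniformly_continuous_on_def dist_real_def by metis
    have "uniformly_continuous_on {0..1} G" by (rule compact_uniformly_continuous[OF contG]) simp
    then obtain d where d: "d > 0"
      "\<And>y y'. y \<in> {0..1} \<Longrightarrow> y' \<in> {0..1} \<Longrightarrow> \<bar>y' - y\<bar> < d \<Longrightarrow> \<bar>G y' - G y\<bar> < d1"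
      using d1(1) unfolding uniformly_continuous_on_def dist_real_def by metis
    have step: "\<bar>D z - D y\<bar> \<le> \<epsilon> * (K z - K y)" if yz: "0 \<le> y" "y \<le> z" "z \<le> 1" "z - y < d" for y z
    proof -
      have Gyz: "\<bar>G y\<bar> \<le> r" "\<bar>G z\<bar> \<le> r" using r[of y] r[of z] yz by auto
      have "\<exists>\<xi>. min (G y) (G z) \<le> \<xi> \<and> \<xi> \<le> max (G y) (G z) \<and> F (G z) - F (G y) = F' \<xi> * (G z - G y)"
      proof -
        consider "G y = G z" | "G y < G z" | "G z < G y" by linarith
        then show ?thesis
        proof cases
          case 1 then show ?thesis by auto
        next
          case 2
          then obtain \<xi> where "G y < \<xi>" "\<xi> < G z" "F (G z) - F (G y) = (G z - G y) * F' \<xi>"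
            using MVT2[of "G y" "G z" F F'] F Gyz by force
          then show ?thesis by (intro exI[of _ \<xi>]) auto
        next
          case 3
          then obtain \<xi> where "G z < \<xi>" "\<xi> < G y" "F (G y) - F (G z) = (G y - G z) * F' \<xi>"
            using MVT2[of "G z" "G y" F F'] F Gyz by force
          then show ?thesis by (intro exI[of _ \<xi>]) (auto simp: algebra_simps)
        qed
      qed
      then obtain \<xi> where \<xi>: "min (G y) (G z) \<le> \<xi>" "\<xi> \<le> max (G y) (G z)" "F (G z) - F (G y) = F' \<xi> * (G z - G y)"
        by blast
      have \<xi>r: "\<xi> \<in> {-r..r}" using \<xi>(1,2) Gyz by (auto simp: min_def max_def split: if_splits)
      note db = primitive_diff[OF b yz(2)] and dF = primitive_diff[OF int yz(2)] and dabs = primitive_diff[OF absb yz(2)]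
      let ?I = "\<lambda>t. if y < t \<and> t \<le> z then 1 else 0 :: real"
      have near: "\<bar>F' \<xi> - F' (G t)\<bar> \<le> \<epsilon>" if "y < t" "t \<le> z" for t
      proof -
        have t: "t \<in> {0..1}" using that yz by auto
        have "\<bar>G y - G t\<bar> < d1" "\<bar>G z - G t\<bar> < d1" using d(2)[of t] t that yz by auto
        then have "\<bar>\<xi> - G t\<bar> < d1" using \<xi>(1,2) by (auto simp: min_def max_def split: if_splits)
        then show ?thesis using d1(2)[OF Gr[OF t] \<xi>r] by simp
      qed
      have "G z - G y = (LINT t|leb01. ?I t * b t)" using db(1) G yz by simp
      then have "D z - D y = F' \<xi> * (LINT t|leb01. ?I t * b t) - (LINT t|leb01. ?I t * (F' (G t) * b t))"
        using \<xi>(3) dF(1) by (simp add: D_def)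
      also have "\<dots> = (LINT t|leb01. F' \<xi> * (?I t * b t) - ?I t * (F' (G t) * b t))"
        using db(2) dF(2) by (subst Bochner_Integration.integral_diff) auto
      finally have "\<bar>D z - D y\<bar> \<le> (LINT t|leb01. \<bar>F' \<xi> * (?I t * b t) - ?I t * (F' (G t) * b t)\<bar>)"
        by (simp only: integral_abs_bound)
      also have "\<dots> \<le> (LINT t|leb01. \<epsilon> * (?I t * \<bar>b t\<bar>))"
      proof (rule integral_mono)
        show "integrable leb01 (\<lambda>t. \<bar>F' \<xi> * (?I t * b t) - ?I t * (F' (G t) * b t)\<bar>)"
          using db(2) dF(2) by (intro integrable_abs Bochner_Integration.integrable_diff integrable_mult_right) auto
        show "integrable leb01 (\<lambda>t. \<epsilon> * (?I t * \<bar>b t\<bar>))" using dabs(2) by (intro integrable_mult_right)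
        fix t
        show "\<bar>F' \<xi> * (?I t * b t) - ?I t * (F' (G t) * b t)\<bar> \<le> \<epsilon> * (?I t * \<bar>b t\<bar>)"
        proof (cases "y < t \<and> t \<le> z")
          case True
          have "\<bar>F' \<xi> * b t - F' (G t) * b t\<bar> = \<bar>F' \<xi> - F' (G t)\<bar> * \<bar>b t\<bar>"
            by (simp add: left_diff_distrib[symmetric] abs_mult)
          also have "\<dots> \<le> \<epsilon> * \<bar>b t\<bar>" using near True by (intro mult_right_mono) auto
          finally show ?thesis using True by simp
        qed auto
      qed
      also have "\<dots> = \<epsilon> * (K z - K y)" using dabs(1) by (simp add: K_def)
      finally show ?thesis .
    qed
    \<comment> \<open>Telescope over a partition of \<open>[0,x]\<close> into \<open>N\<close> intervals shorter than \<open>d\<close>.\<close>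
    obtain n where n: "1 / real (Suc n) < d" using nat_approx_posE[OF d(1)] by blast
    define N where "N = Suc n"
    have N: "0 < real N" "1 / real N < d" using n by (auto simp: N_def)
    have "\<bar>D (real k * x / real N)\<bar> \<le> \<epsilon> * K (real k * x / real N)" if "k \<le> N" for k
      using that
    proof (induction k)
      case 0 then show ?case using D0 by simp
    next
      case (Suc k)
      let ?y = "real k * x / real N" and ?z = "real (Suc k) * x / real N"
      have xN: "real (Suc k) * x \<le> real N * 1"
        using Suc(2) x by (intro mult_mono) auto
      have "x / real N \<le> 1 / real N" using x N(1) by (intro divide_right_mono) auto
      moreover have "?z - ?y = x / real N" by (simp add: diff_divide_distrib[symmetric] algebra_simps)
      ultimately have "?z - ?y < d" using N(2) by linarith
      moreover have "?y \<le> ?z" using x N(1) by (intro divide_right_mono mult_right_mono) auto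
      moreover have "0 \<le> ?y" using x by simp
      moreover have "?z \<le> 1" using xN N(1) by (simp add: field_simps)
      ultimately have "\<bar>D ?z - D ?y\<bar> \<le> \<epsilon> * (K ?z - K ?y)" by (intro step)
      moreover have "\<bar>D ?y\<bar> \<le> \<epsilon> * K ?y" using Suc by simp
      ultimately show ?case by (simp add: right_diff_distrib)
    qed
    from this[of N] show ?thesis using N(1) by simp
  qed
  show "F (G x) = F (G 0) + primitive leb01 (\<lambda>t. F' (G t) * b t) x" if x: "x \<in> {0..1}"
  proof -
    have "\<bar>D x\<bar> \<le> 0"
    proof (rule field_le_epsilon)
      fix e :: real assume e: "0 < e"
      have "0 \<le> K x" unfolding K_def primitive_def by (rule integral_nonneg_AE) auto
      then have "e / (K x + 1) * K x \<le> e" using e by (simp add: field_simps)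
      then show "\<bar>D x\<bar> \<le> 0 + e" using main[OF x, of "e / (K x + 1)"] e \<open>0 \<le> K x\<close> by auto
    qed
    then show ?thesis by (simp add: D_def)
  qed
qed

section \<open>Solutions with a small right-hand side are regular\<close>

lemma emeasure_space_0_imp_AE:
  assumes "emeasure M (space M) = 0"
  shows "AE x in M. P x"
proof -
  have "space M \<in> null_sets M" using assms by (auto simp: null_sets_def)
  then have "AE x in M. x \<notin> space M" by (rule AE_not_in)
  then show ?thesis using AE_space by eventually_elim simp
qed

text \<open>Primitives of integrable functions have no singular derivative, so they are admissible whatever
  the singular part of \<open>u\<close> is, and the singular term of the weak formulation disappears.\<close>

lemma bv_solution_test_ac:
  assumes u: "bv_solution lam a f u" and w: "integrable leb01 w"
  shows "(LINT x|leb01. deriv_ac u x * w x / sqrt (1 + (deriv_ac u x)\<^sup>2))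
    = (LINT x|leb01. lam * a x * f (u x) * (c + primitive leb01 w x))"
proof -
  interpret L: finite_measure leb01 by (rule finite_measure_leb01)
  define \<phi> where "\<phi> x = c + primitive leb01 w x" for x
  have \<phi>: "integrable leb01 \<phi>" "is_derivative_measure \<phi> (\<lambda>A. LINT x:A|leb01. w x)"
    by (rule primitive_derivative_measure[OF L.sigma_finite_measure_axioms has_density_on_leb01[OF w]];
        simp add: \<phi>_def)+
  note parts = deriv_parts_eq[OF \<phi> lebesgue_decomposition_ac[OF w]]
  have uBV: "u \<in> BV01" using u by (simp add: bv_solution_def)
  let ?T = "total_variation borel01 (deriv_sing \<phi>)"
  have sing: "signed_measure_on borel01 (deriv_sing \<phi>)"
    using lebesgue_decomposition_deriv[OF parts(1)] by (simp add: lebesgue_decomposition_def)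
  have null: "emeasure ?T (space ?T) = 0"
    using emeasure_total_variation_eq_0[OF sing, of I01] parts(3) by (auto simp: sets_borel01)
  have "absolutely_continuous (total_variation borel01 (deriv_sing u)) ?T"
    unfolding absolutely_continuous_def
  proof
    fix A assume "A \<in> null_sets (total_variation borel01 (deriv_sing u))"
    then have A: "A \<in> sets borel01" by auto
    then have "emeasure ?T A = 0"
      using emeasure_total_variation_eq_0[OF sing A] parts(3) by auto
    then show "A \<in> null_sets ?T" using A by (auto simp: null_sets_def)
  qed
  then have "(LINT x|leb01. deriv_ac u x * deriv_ac \<phi> x / sqrt (1 + (deriv_ac u x)\<^sup>2))
        + signed_integral borel01 (deriv_sing \<phi>) (polar_density borel01 (deriv_sing u))
        = (LINT x|leb01. lam * a x * f (u x) * \<phi> x)"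
    using u parts(1) by (auto simp: bv_solution_def)
  moreover have "signed_integral borel01 (deriv_sing \<phi>) (polar_density borel01 (deriv_sing u)) = 0"
    unfolding signed_integral_def by (rule integral_eq_zero_AE[OF emeasure_space_0_imp_AE[OF null]])
  moreover have "(LINT x|leb01. deriv_ac u x * deriv_ac \<phi> x / sqrt (1 + (deriv_ac u x)\<^sup>2))
    = (LINT x|leb01. deriv_ac u x * w x / sqrt (1 + (deriv_ac u x)\<^sup>2))"
  proof (rule integral_cong_AE)
    have [measurable]: "deriv_ac u \<in> borel_measurable leb01" "deriv_ac \<phi> \<in> borel_measurable leb01" "w \<in> borel_measurable leb01"
      using lebesgue_decomposition_deriv[OF uBV] lebesgue_decomposition_deriv[OF parts(1)] w
      by (auto simp: lebesgue_decomposition_def)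
    show "(\<lambda>x. deriv_ac u x * deriv_ac \<phi> x / sqrt (1 + (deriv_ac u x)\<^sup>2)) \<in> borel_measurable leb01"
      "(\<lambda>x. deriv_ac u x * w x / sqrt (1 + (deriv_ac u x)\<^sup>2)) \<in> borel_measurable leb01" by measurable
    show "AE x in leb01. deriv_ac u x * deriv_ac \<phi> x / sqrt (1 + (deriv_ac u x)\<^sup>2) = deriv_ac u x * w x / sqrt (1 + (deriv_ac u x)\<^sup>2)"
      using parts(2) by eventually_elim simp
  qed
  ultimately show ?thesis by (simp add: \<phi>_def)
qed

text \<open>Test with the primitive \<open>\<phi>\<close> of the singular part of the derivative of \<open>u\<close> itself. The left-hand
  side is then the total variation \<open>\<tau>\<close> of that singular part, while \<open>\<bar>\<phi>\<bar> \<le> \<tau>\<close> bounds the right-hand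
  side by \<open>\<tau>\<close> times an \<open>L\<^sup>1\<close> norm that is smaller than 1. So \<open>\<tau> = 0\<close>.\<close>

lemma bv_solution_singular_part_eq_0:
  assumes u: "bv_solution lam a f u" and b: "integrable leb01 (\<lambda>x. lam * a x * f (u x))"
    and small: "(LINT x|leb01. \<bar>lam * a x * f (u x)\<bar>) < 1" and A: "A \<in> sets borel01"
  shows "deriv_sing u A = 0"
proof -
  define b where "b x = lam * a x * f (u x)" for x
  let ?\<nu> = "deriv_sing u" and ?\<sigma> = "polar_density borel01 (deriv_sing u)"
  let ?T = "total_variation borel01 ?\<nu>"
  have uBV: "u \<in> BV01" using u by (simp add: bv_solution_def)
  note dec = lebesgue_decomposition_deriv[OF uBV]
  have \<nu>: "signed_measure_on borel01 ?\<nu>" using dec by (simp add: lebesgue_decomposition_def)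
  interpret T: finite_measure ?T by (rule finite_measure_total_variation[OF \<nu>])
  interpret L: finite_measure leb01 by (rule finite_measure_leb01)
  note d = polar_density(1)[OF \<nu>] note D = has_density_onD[OF d]
  define \<phi> where "\<phi> x = primitive ?T ?\<sigma> x" for x
  have \<phi>: "integrable leb01 \<phi>" "is_derivative_measure \<phi> ?\<nu>"
    by (rule primitive_derivative_measure[OF T.sigma_finite_measure_axioms d, where c=0]; simp add: \<phi>_def)+
  note parts = deriv_parts_eq[OF \<phi> lebesgue_decomposition_sing[OF dec]]
  have TV: "total_variation borel01 (deriv_sing \<phi>) = ?T"
    by (rule total_variation_cong[OF parts(3)])
  have pd: "polar_density borel01 (deriv_sing \<phi>) = ?\<sigma>"
    by (rule polar_density_cong[OF parts(3)])
  have "(LINT x|leb01. deriv_ac u x * deriv_ac \<phi> x / sqrt (1 + (deriv_ac u x)\<^sup>2))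
        + signed_integral borel01 (deriv_sing \<phi>) ?\<sigma> = (LINT x|leb01. b x * \<phi> x)"
    using u parts(1) by (auto simp: bv_solution_def TV absolutely_continuous_def b_def)
  moreover have "(LINT x|leb01. deriv_ac u x * deriv_ac \<phi> x / sqrt (1 + (deriv_ac u x)\<^sup>2)) = 0"
    by (rule integral_eq_zero_AE) (use parts(2) in \<open>eventually_elim, simp\<close>)
  moreover have "signed_integral borel01 (deriv_sing \<phi>) ?\<sigma> = measure ?T I01"
  proof -
    have "(LINT x|?T. ?\<sigma> x * ?\<sigma> x) = (LINT x|?T. 1)"
    proof (rule integral_cong_AE)
      show "AE x in ?T. ?\<sigma> x * ?\<sigma> x = 1"
        using polar_density(2)[OF \<nu>] by eventually_elim (metis abs_mult_self_eq mult_1)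
    qed (use D(3) in auto)
    then show ?thesis unfolding signed_integral_def TV pd by simp
  qed
  moreover have "(LINT x|?T. \<bar>?\<sigma> x\<bar>) = measure ?T I01"
  proof -
    have "(LINT x|?T. \<bar>?\<sigma> x\<bar>) = (LINT x|?T. 1)"
      by (rule integral_cong_AE) (use polar_density(2)[OF \<nu>] D(3) in auto)
    then show ?thesis by simp
  qed
  then have \<phi>_bound: "\<bar>\<phi> x\<bar> \<le> measure ?T I01" for x
    using primitive_bound[OF D(3), of x] by (simp add: \<phi>_def)
  have bi: "integrable leb01 b" using b by (simp add: b_def[abs_def])
  have "(LINT x|leb01. b x * \<phi> x) \<le> (LINT x|leb01. measure ?T I01 * \<bar>b x\<bar>)"
  proof (rule integral_mono)
    show "integrable leb01 (\<lambda>x. b x * \<phi> x)"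
      using integrable_bounded_mult[OF bi borel_measurable_integrable[OF \<phi>(1)] \<phi>_bound] by (simp add: mult.commute)
    show "integrable leb01 (\<lambda>x. measure ?T I01 * \<bar>b x\<bar>)" using bi by auto
    fix x
    have "b x * \<phi> x \<le> \<bar>b x\<bar> * \<bar>\<phi> x\<bar>" by (metis abs_ge_self abs_mult)
    also have "\<dots> \<le> \<bar>b x\<bar> * measure ?T I01" using \<phi>_bound by (intro mult_left_mono) auto
    finally show "b x * \<phi> x \<le> measure ?T I01 * \<bar>b x\<bar>" by (simp add: mult.commute)
  qed
  ultimately have "measure ?T I01 \<le> measure ?T I01 * (LINT x|leb01. \<bar>b x\<bar>)" by simp
  then have "measure ?T I01 * (1 - (LINT x|leb01. \<bar>b x\<bar>)) \<le> 0" by (simp add: algebra_simps)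
  then have "measure ?T I01 \<le> 0" using small by (simp add: b_def mult_le_0_iff)
  then have "emeasure ?T I01 = 0" by (simp add: T.emeasure_eq_measure measure_le_0_iff)
  moreover have "I01 \<in> sets borel01" "A \<subseteq> I01" using A by (auto simp: sets_borel01)
  ultimately show ?thesis using total_variation_null_subset[OF \<nu> _ _ A] by blast
qed

text \<open>Testing with constants gives the first claim. It makes the integral of \<open>b\<close> over \<open>[t,1]\<close> equal to
  minus the integral over \<open>[0,t]\<close>, so that testing with the primitive of \<open>w\<close> says that the flux minus
  \<open>- primitive leb01 b\<close> is orthogonal to \<open>w\<close>. This difference is bounded, so it may be chosen as \<open>w\<close>.\<close>

lemma bv_solution_flux:
  fixes u :: "real \<Rightarrow> real"
  assumes u: "bv_solution lam a f u" and b: "integrable leb01 (\<lambda>x. lam * a x * f (u x))"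
  defines "b \<equiv> (\<lambda>x. lam * a x * f (u x))"
  shows "(LINT x|leb01. b x) = 0"
    and "AE x in leb01. deriv_ac u x / sqrt (1 + (deriv_ac u x)\<^sup>2) = - primitive leb01 b x"
proof -
  interpret L: finite_measure leb01 by (rule finite_measure_leb01)
  have uBV: "u \<in> BV01" using u by (simp add: bv_solution_def)
  have bi: "integrable leb01 b" using b by (simp add: b_def)
  show b0: "(LINT x|leb01. b x) = 0"
    using bv_solution_test_ac[OF u, of "\<lambda>_. 0" 1] by (simp add: primitive_def b_def)
  define g where "g x = deriv_ac u x / sqrt (1 + (deriv_ac u x)\<^sup>2)" for x
  have [measurable]: "deriv_ac u \<in> borel_measurable leb01"
    using lebesgue_decomposition_deriv[OF uBV] by (auto simp: lebesgue_decomposition_def)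
  have g_meas: "g \<in> borel_measurable leb01" unfolding g_def[abs_def] by measurable
  have g_bound: "\<bar>g x\<bar> \<le> 1" for x
  proof -
    have "\<bar>deriv_ac u x\<bar> \<le> sqrt (1 + (deriv_ac u x)\<^sup>2)" by (rule real_le_rsqrt) simp
    moreover have "0 < sqrt (1 + (deriv_ac u x)\<^sup>2)" by (simp add: add_pos_nonneg)
    ultimately show ?thesis by (simp add: g_def abs_divide)
  qed
  have P_meas: "primitive leb01 b \<in> borel_measurable leb01"
    by (rule continuous_imp_measurable_on_sets_lebesgue[OF continuous_on_primitive[OF bi]]) auto
  define w where "w x = g x + primitive leb01 b x" for x
  define B where "B = 1 + (LINT t|leb01. \<bar>b t\<bar>)"
  have w_meas: "w \<in> borel_measurable leb01" using g_meas P_meas unfolding w_def[abs_def] by measurable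
  have w_bound: "\<bar>w x\<bar> \<le> B" for x
    unfolding w_def B_def by (rule order_trans[OF abs_triangle_ineq add_mono[OF g_bound primitive_bound[OF bi]]])
  have wi: "integrable leb01 w"
    by (rule L.integrable_const_bound[where B=B]) (use w_bound w_meas in auto)
  have tail: "(LINT x|leb01. (if t \<le> x then 1 else 0) * b x) = - primitive leb01 b t" for t
  proof -
    have meas_le: "(\<lambda>x. (if x \<le> t then 1 else 0) * b x) \<in> borel_measurable leb01"
      using integrable_indicator_le[OF bi] by blast
    have "(LINT x|leb01. (if t \<le> x then 1 else 0) * b x) = (LINT x|leb01. b x - (if x \<le> t then 1 else 0) * b x)"
    proof (rule integral_cong_AE)
      have "(\<lambda>x. if t \<le> x then 1 else 0 :: real) \<in> borel_measurable borel01"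
        by (rule measurable_borel01) measurable
      then have "(\<lambda>x. if t \<le> x then 1 else 0 :: real) \<in> borel_measurable leb01"
        by (rule measurable_larger_sets[OF _ sets_borel01_leb01, rotated]) simp
      then show "(\<lambda>x. (if t \<le> x then 1 else 0) * b x) \<in> borel_measurable leb01"
        using bi by (intro borel_measurable_times) auto
      show "(\<lambda>x. b x - (if x \<le> t then 1 else 0) * b x) \<in> borel_measurable leb01"
        using meas_le bi by (intro borel_measurable_diff) auto
      show "AE x in leb01. (if t \<le> x then 1 else 0) * b x = b x - (if x \<le> t then 1 else 0) * b x"
        using AE_leb01_neq[of t] by eventually_elim auto
    qed
    also have "\<dots> = (LINT x|leb01. b x) - primitive leb01 b t"
      unfolding primitive_def by (rule Bochner_Integration.integral_diff[OF bi integrable_indicator_le[OF bi]])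
    finally show ?thesis using b0 by simp
  qed
  have "(LINT x|leb01. g x * w x) = (LINT x|leb01. b x * (0 + primitive leb01 w x))"
    using bv_solution_test_ac[OF u wi, of 0] by (simp add: g_def b_def)
  also have "\<dots> = (LINT x|leb01. primitive leb01 w x * b x)" by (simp add: mult.commute)
  also have "\<dots> = (LINT t|leb01. w t * (LINT x|leb01. (if t \<le> x then 1 else 0) * b x))"
    by (rule integral_primitive_swap(2)[OF L.sigma_finite_measure_axioms _ sets_borel01_leb01 wi
          L.sigma_finite_measure_axioms _ sets_borel01_leb01 bi]) auto
  also have "\<dots> = (LINT t|leb01. - (primitive leb01 b t * w t))"
    by (simp only: tail) (simp add: mult.commute)
  finally have eq: "(LINT x|leb01. g x * w x) = (LINT t|leb01. - (primitive leb01 b t * w t))" .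
  have gi: "integrable leb01 (\<lambda>x. g x * w x)"
    using g_bound by (intro integrable_bounded_mult[OF wi g_meas, where B=1])
  have Pi: "integrable leb01 (\<lambda>x. primitive leb01 b x * w x)"
    using primitive_bound[OF bi] by (intro integrable_bounded_mult[OF wi P_meas])
  have "(LINT x|leb01. w x * w x) = (LINT x|leb01. g x * w x + primitive leb01 b x * w x)"
    by (rule Bochner_Integration.integral_cong) (auto simp: w_def algebra_simps)
  also have "\<dots> = 0" using eq gi Pi by simp
  finally have "(LINT x|leb01. w x * w x) = 0" .
  moreover have "integrable leb01 (\<lambda>x. w x * w x)"
    using w_bound by (intro integrable_bounded_mult[OF wi w_meas])
  ultimately have "AE x in leb01. w x * w x = 0"
    by (subst (asm) integral_nonneg_eq_0_iff_AE) auto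
  then show "AE x in leb01. deriv_ac u x / sqrt (1 + (deriv_ac u x)\<^sup>2) = - primitive leb01 b x"
    by eventually_elim (simp add: w_def g_def)
qed

text \<open>The function \<open>y / sqrt (1 - y\<^sup>2)\<close> recovers a slope \<open>v\<close> from its flux \<open>y = v / sqrt (1 + v\<^sup>2)\<close>. It is
  smooth only for \<open>\<bar>y\<bar> < 1\<close>, which is where smallness of the flux enters.\<close>

lemma has_real_derivative_flux_inverse:
  assumes "\<bar>y\<bar> < (1::real)"
  shows "((\<lambda>y. y / sqrt (1 - y\<^sup>2)) has_real_derivative 1 / sqrt (1 - y\<^sup>2) ^ 3) (at y)"
proof -
  have p: "0 < 1 - y\<^sup>2" using assms by (simp add: abs_square_less_1)
  define s where "s = sqrt (1 - y\<^sup>2)"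
  have s: "s > 0" "s * s = 1 - y\<^sup>2" using p by (auto simp: s_def)
  have "((\<lambda>y. y / sqrt (1 - y\<^sup>2)) has_real_derivative
      (1 * sqrt (1 - y\<^sup>2) - y * (inverse (sqrt (1 - y\<^sup>2)) / 2 * (- (2 * y)))) / (sqrt (1 - y\<^sup>2) * sqrt (1 - y\<^sup>2))) (at y)"
    using p by (auto intro!: derivative_eq_intros)
  moreover have "(1 * s - y * (inverse s / 2 * (- (2 * y)))) / (s * s) = 1 / s ^ 3"
  proof -
    have "(1 * s - y * (inverse s / 2 * (- (2 * y)))) = (s * s + y\<^sup>2) / s"
      using s(1) by (simp add: field_simps power2_eq_square)
    also have "\<dots> = 1 / s" using s(2) by simp
    finally show ?thesis using s(1) by (simp add: power3_eq_cube)
  qed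
  ultimately show ?thesis by (simp add: s_def)
qed

lemma flux_inverse:
  fixes v y :: real
  shows "v / sqrt (1 + v\<^sup>2) = y \<Longrightarrow> v = y / sqrt (1 - y\<^sup>2)"
    and "\<bar>y\<bar> < 1 \<Longrightarrow> (y / sqrt (1 - y\<^sup>2)) / sqrt (1 + (y / sqrt (1 - y\<^sup>2))\<^sup>2) = y"
proof -
  assume y: "v / sqrt (1 + v\<^sup>2) = y"
  have p: "0 < 1 + v\<^sup>2" by (simp add: add_pos_nonneg)
  have "1 - y\<^sup>2 = 1 / (1 + v\<^sup>2)"
    using p unfolding y[symmetric] by (simp add: power_divide field_simps)
  then have "sqrt (1 - y\<^sup>2) = 1 / sqrt (1 + v\<^sup>2)" by (simp add: real_sqrt_divide)
  moreover have "sqrt (1 + v\<^sup>2) \<noteq> 0" using p by simp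
  ultimately show "v = y / sqrt (1 - y\<^sup>2)" unfolding y[symmetric] by simp
next
  assume "\<bar>y\<bar> < 1"
  then have p: "0 < 1 - y\<^sup>2" by (simp add: abs_square_less_1)
  have "1 + (y / sqrt (1 - y\<^sup>2))\<^sup>2 = 1 / (1 - y\<^sup>2)"
    using p by (simp add: power_divide field_simps)
  then have "sqrt (1 + (y / sqrt (1 - y\<^sup>2))\<^sup>2) = 1 / sqrt (1 - y\<^sup>2)" by (simp add: real_sqrt_divide)
  then show "(y / sqrt (1 - y\<^sup>2)) / sqrt (1 + (y / sqrt (1 - y\<^sup>2))\<^sup>2) = y" using p by simp
qed

text \<open>The flux is minus the primitive of \<open>b\<close>, which is absolutely continuous, vanishes at both ends of
  the interval and is bounded by the \<open>L\<^sup>1\<close> norm of \<open>b\<close>, hence stays away from \<open>\<plusminus>1\<close>. Inverting the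
  relation between flux and slope therefore gives an absolutely continuous slope that vanishes at
  both ends, and without a singular part this slope is the full derivative of \<open>u\<close>.\<close>

lemma bv_solution_regular_if_small:
  assumes u: "bv_solution lam a f u" and b: "integrable leb01 (\<lambda>x. lam * a x * f (u x))"
    and small: "(LINT x|leb01. \<bar>lam * a x * f (u x)\<bar>) < 1"
  shows "regular_solution lam a f u"
proof -
  define b where "b x = lam * a x * f (u x)" for x
  define r where "r = (LINT x|leb01. \<bar>b x\<bar>)"
  have bi: "integrable leb01 b" using b by (simp add: b_def[abs_def])
  have uBV: "u \<in> BV01" using u by (simp add: bv_solution_def)
  define G where "G x = - primitive leb01 b x" for x
  have r1: "r < 1" using small by (simp add: r_def b_def)
  have Gr: "\<bar>G x\<bar> \<le> r" for x using primitive_bound[OF bi, of x] by (simp add: G_def r_def)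
  have G1: "\<bar>G x\<bar> < 1" for x using Gr[of x] r1 by linarith
  note flux = bv_solution_flux[OF u b, folded b_def[abs_def]]
  have "G = primitive leb01 (\<lambda>x. - b x)"
    by (rule ext) (simp add: G_def primitive_def)
  then have G_prim: "G x = 0 + primitive leb01 (\<lambda>x. - b x) x" for x by simp
  have nbi: "integrable leb01 (\<lambda>x. - b x)" using bi by auto
  define F where "F y = y / sqrt (1 - y\<^sup>2)" for y :: real
  define F' where "F' y = 1 / sqrt (1 - y\<^sup>2) ^ 3" for y :: real
  define u1 where "u1 x = F (G x)" for x
  define u2 where "u2 x = F' (G x) * - b x" for x
  have pos: "0 < 1 - y\<^sup>2" if "\<bar>y\<bar> \<le> r" for y
    using that r1 by (simp add: abs_square_less_1)
  have contF': "continuous_on {-r..r} F'"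
    unfolding F'_def[abs_def] by (intro continuous_intros ballI) (metis pos abs_le_iff atLeastAtMost_iff less_irrefl minus_le_iff power_eq_0_iff real_sqrt_eq_0_iff)
  note chain = chain_rule_primitive[OF nbi G_prim Gr _ contF', of F, folded u2_def[abs_def] u1_def]
  have dF: "(F has_real_derivative F' y) (at y)" if "\<bar>y\<bar> \<le> r" for y
    unfolding F_def[abs_def] F'_def using that r1 by (intro has_real_derivative_flux_inverse) simp
  have u2i: "integrable leb01 u2" by (rule chain(1)[OF dF])
  have u1_prim: "u1 x = u1 0 + primitive leb01 u2 x" if "x \<in> {0..1}" for x
    by (rule chain(2)[OF dF that])
  have "G 0 = 0" "G 1 = 0" using flux(1) by (simp_all add: G_def primitive_0 primitive_1)
  then have u1_0: "u1 0 = 0" "u1 1 = 0" by (simp_all add: u1_def F_def)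
  have contu1: "continuous_on {0..1} u1"
    by (rule continuous_on_eq[where f="\<lambda>x. u1 0 + primitive leb01 u2 x"])
       (intro continuous_intros continuous_on_primitive[OF u2i], erule u1_prim[symmetric])
  have wd1: "weak_deriv u1 u2"
    by (rule weak_deriv_primitive[OF u2i, where c="u1 0"]) (rule u1_prim, simp)
  have wdG: "weak_deriv (\<lambda>x. u1 x / sqrt (1 + (u1 x)\<^sup>2)) (\<lambda>x. - b x)"
    by (rule weak_deriv_primitive[OF nbi, where c=0])
       (simp only: u1_def F_def flux_inverse(2)[OF G1] G_prim[symmetric])
  have AEu1: "AE x in leb01. deriv_ac u x = u1 x"
    using flux(2) by eventually_elim (unfold u1_def F_def G_def, erule flux_inverse(1))
  have u1i: "integrable leb01 u1" using wd1 by (simp add: weak_deriv_def)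
  have wd0: "weak_deriv u u1"
    unfolding weak_deriv_def
  proof (intro conjI allI impI)
    show "integrable leb01 u" using uBV by (simp add: BV01_def)
    show "integrable leb01 u1" by (rule u1i)
    fix \<phi> assume \<phi>: "test_function \<phi>"
    obtain B where B: "\<And>x. \<bar>\<phi> x\<bar> \<le> B" "\<And>x. x \<in> I01 \<Longrightarrow> \<bar>deriv \<phi> x\<bar> \<le> B"
      using test_function_bounds[OF \<phi>] by blast
    note dec = lebesgue_decomposition_deriv[OF uBV]
    have aci: "integrable leb01 (deriv_ac u)" using dec by (simp add: lebesgue_decomposition_def)
    have "has_density_on borel01 (deriv_measure u) leb01 (deriv_ac u)"
      unfolding has_density_on_def
    proof (intro conjI ballI)
      fix A assume A: "A \<in> sets borel01"
      then show "deriv_measure u A = (LINT x:A|leb01. deriv_ac u x)"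
        using dec bv_solution_singular_part_eq_0[OF u b small A] by (simp add: lebesgue_decomposition_def)
    qed (use sets_borel01_leb01 aci in auto)
    then have "signed_integral borel01 (deriv_measure u) \<phi> = (LINT x|leb01. \<phi> x * deriv_ac u x)"
      by (rule signed_integral_density[OF _ test_function_measurable(1)[OF \<phi>] B(1)])
    also have "\<dots> = (LINT x|leb01. u1 x * \<phi> x)"
    proof (rule integral_cong_AE)
      have [measurable]: "\<phi> \<in> borel_measurable leb01"
        by (rule measurable_larger_sets[OF _ sets_borel01_leb01 test_function_measurable(1)[OF \<phi>]]) simp
      have [measurable]: "deriv_ac u \<in> borel_measurable leb01" "u1 \<in> borel_measurable leb01" using aci u1i by auto
      show "(\<lambda>x. \<phi> x * deriv_ac u x) \<in> borel_measurable leb01" "(\<lambda>x. u1 x * \<phi> x) \<in> borel_measurable leb01"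
        by measurable
      show "AE x in leb01. \<phi> x * deriv_ac u x = u1 x * \<phi> x" using AEu1 by eventually_elim simp
    qed
    finally show "(LINT x|leb01. u x * deriv \<phi> x) = - (LINT x|leb01. u1 x * \<phi> x)"
      using is_derivative_measure_deriv_measure[OF uBV] \<phi> by (simp add: is_derivative_measure_def)
  qed
  show ?thesis
    unfolding regular_solution_def
    by (intro exI[of _ u1] exI[of _ u2] exI[of _ "\<lambda>x. - b x"] conjI wd0 wd1 wdG contu1 u1_0)
       (simp add: b_def)
qed

section \<open>Smallness of the parameter\<close>

text \<open>For large \<open>u\<close> the quotient is bounded and the factor \<open>u powr (- q)\<close> is at most 1; continuity
  takes care of the remaining compact interval.\<close>

lemma bounded_if_power_decay:
  fixes f :: "real \<Rightarrow> real"
  assumes cont: "continuous_on UNIV f" and q: "q > 0"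
    and lim: "((\<lambda>u. f u / u powr (- q)) \<longlongrightarrow> h) at_top"
  obtains B where "B > 0" "\<And>u. u \<ge> 0 \<Longrightarrow> \<bar>f u\<bar> \<le> B"
proof -
  have "((\<lambda>u. \<bar>f u / u powr (- q)\<bar>) \<longlongrightarrow> \<bar>h\<bar>) at_top" by (rule tendsto_rabs[OF lim])
  then have "\<forall>\<^sub>F u in at_top. \<bar>f u / u powr (- q)\<bar> < \<bar>h\<bar> + 1" by (rule order_tendstoD) simp
  then obtain R where R: "\<And>u. u \<ge> R \<Longrightarrow> \<bar>f u / u powr (- q)\<bar> < \<bar>h\<bar> + 1"
    by (auto simp: eventually_at_top_linorder)
  have "bounded (f ` {0..max R 1})"
    by (intro compact_imp_bounded compact_continuous_image continuous_on_subset[OF cont]) auto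
  then obtain C where C: "\<forall>u\<in>{0..max R 1}. \<bar>f u\<bar> \<le> C" unfolding bounded_iff by auto
  have "\<bar>f u\<bar> \<le> max C (\<bar>h\<bar> + 1)" if u: "u \<ge> 0" for u
  proof (cases "u \<le> max R 1")
    case True
    then have "\<bar>f u\<bar> \<le> C" using C u by auto
    then show ?thesis by simp
  next
    case False
    then have u: "u \<ge> R" "u \<ge> 1" by auto
    have p: "0 < u powr (- q)" "u powr (- q) \<le> 1"
      using u q by (auto simp: powr_minus inverse_le_1_iff ge_one_powr_ge_zero)
    have "\<bar>f u\<bar> = \<bar>f u / u powr (- q)\<bar> * u powr (- q)" using p by (simp add: abs_divide)
    also have "\<dots> \<le> (\<bar>h\<bar> + 1) * 1" using R[OF u(1)] p by (intro mult_mono) auto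
    finally show ?thesis by simp
  qed
  then show ?thesis by (intro that[of "max C (\<bar>h\<bar> + 1)"]) (auto simp: less_max_iff_disj)
qed

lemma ess_positive_AE_nonneg:
  assumes "ess_positive u"
  shows "AE x in leb01. 0 \<le> u x"
proof -
  have "\<forall>\<^sub>F x in ae_filter leb01. ereal (- 1 / real (Suc n)) < ereal (u x)" for n
  proof -
    have "ereal (- 1 / real (Suc n)) < (0::ereal)" by (simp add: divide_neg_pos)
    moreover have "\<forall>y<0. \<forall>\<^sub>F x in ae_filter leb01. y < ereal (u x)"
      using assms by (simp add: ess_positive_def le_Liminf_iff)
    ultimately show ?thesis by blast
  qed
  then have "AE x in leb01. \<forall>n. ereal (- 1 / real (Suc n)) < ereal (u x)"
    by (simp add: AE_all_countable)
  then show ?thesis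
  proof eventually_elim
    fix x assume *: "\<forall>n. ereal (- 1 / real (Suc n)) < ereal (u x)"
    show "0 \<le> u x"
    proof (rule ccontr)
      assume "\<not> 0 \<le> u x"
      then obtain n where "1 / real (Suc n) < - u x"
        using nat_approx_posE[of "- u x"] by auto
      moreover have "- 1 / real (Suc n) < u x" using *[rule_format, of n] by simp
      ultimately show False by linarith
    qed
  qed
qed

theorem lemma2p1:
  fixes a f :: "real \<Rightarrow> real" and h p q :: real
  assumes "integrable leb01 a"
    and "(LINT x|leb01. a x) < 0"
    and "emeasure leb01 {x \<in> I01. a x > 0} > 0"
    and "continuous_on UNIV f"
    and "f 0 = 0"
    and "\<And>u. u > 0 \<Longrightarrow> f u > 0"
    and "h > 0" and "p > 0" and "0 < q" and "q < 1"
    and "((\<lambda>u. f u / u powr p) \<longlongrightarrow> 1) (at_right 0)"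
    and "((\<lambda>u. f u / u powr (- q)) \<longlongrightarrow> h) at_top"
  shows "\<exists>lam_bar > 0. \<forall>lam. 0 \<le> lam \<and> lam < lam_bar \<longrightarrow>
           \<not> (\<exists>u. ess_positive u \<and> singular_solution lam a f u)"
proof -
  obtain B where B: "B > 0" "\<And>u. u \<ge> 0 \<Longrightarrow> \<bar>f u\<bar> \<le> B"
    using bounded_if_power_decay[OF assms(4,9,12)] by blast
  \<comment> \<open>For \<open>lam < 1 / (A * B)\<close> the right-hand side has \<open>L\<^sup>1\<close> norm below 1.\<close>
  define A where "A = (LINT x|leb01. \<bar>a x\<bar>) + 1"
  have A: "A > 0" "(LINT x|leb01. \<bar>a x\<bar>) < A"
    by (auto simp: A_def intro!: add_nonneg_pos integral_nonneg_AE)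
  have "regular_solution lam a f u"
    if lam: "0 \<le> lam" "lam < 1 / (A * B)" and u: "ess_positive u" "bv_solution lam a f u" for lam u
  proof -
    have "u \<in> BV01" using u(2) by (simp add: bv_solution_def)
    then have um: "u \<in> borel_measurable leb01" by (auto simp: BV01_def)
    have fm: "f \<in> borel_measurable borel" by (rule borel_measurable_continuous_onI[OF assms(4)])
    have [measurable]: "a \<in> borel_measurable leb01" "(\<lambda>x. f (u x)) \<in> borel_measurable leb01"
      using assms(1) measurable_compose[OF um fm] by auto
    have bound: "AE x in leb01. norm (lam * a x * f (u x)) \<le> lam * B * \<bar>a x\<bar>"
      using ess_positive_AE_nonneg[OF u(1)]
    proof eventually_elim
      fix x assume "0 \<le> u x"
      then have "\<bar>f (u x)\<bar> * (lam * \<bar>a x\<bar>) \<le> B * (lam * \<bar>a x\<bar>)"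
        using B lam by (intro mult_right_mono) auto
      then show "norm (lam * a x * f (u x)) \<le> lam * B * \<bar>a x\<bar>"
        using lam(1) by (simp add: abs_mult ac_simps)
    qed
    have ai: "integrable leb01 (\<lambda>x. lam * B * \<bar>a x\<bar>)" using assms(1) by auto
    have bi: "integrable leb01 (\<lambda>x. lam * a x * f (u x))"
      by (rule Bochner_Integration.integrable_bound[OF ai]) (use bound in \<open>auto elim: AE_mp\<close>)
    have "(LINT x|leb01. \<bar>lam * a x * f (u x)\<bar>) \<le> (LINT x|leb01. lam * B * \<bar>a x\<bar>)"
      using bound by (intro integral_mono_AE integrable_abs bi ai) auto
    also have "\<dots> = lam * B * (LINT x|leb01. \<bar>a x\<bar>)" by simp
    also have "\<dots> \<le> lam * B * A" using A lam(1) B(1) by (intro mult_left_mono) auto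
    also have "\<dots> < 1" using lam(2) A B by (simp add: field_simps)
    finally show ?thesis by (rule bv_solution_regular_if_small[OF u(2) bi])
  qed
  then show ?thesis
    using A B by (intro exI[of _ "1 / (A * B)"]) (auto simp: singular_solution_def)
qed

end
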